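(* Let $(\phi,\eta,\xi)$ be an almost paracontact Finsler structure on a vector bundle $E$. If $N^{(1)}=0$, then $N^{(2)}=0$, $N^{(3)}=0$ and $N^{(4)}=0$.
   Context: Setting. $(E,\pi,M)$ is a smooth vector bundle with $\dim M=n$ and fibre dimension $m$; $E$ also denotes the $(n+m)$-dimensional total space. $VE$ is the vertical bundle, and a nonlinear connection is fixed, i.e. a smooth distribution $HE$ on $E$ with $TE=HE\oplus VE$. For a vector field $X$ on $E$, $X^H$ and $X^V$ denote its horizontal and vertical components, so $X=X^H+X^V$. For a 1-form $\omega$ on $E$, $\omega^H(X)=\omega(X^H)$ and $\omega^V(X)=\omega(X^V)$. Almost paracontact Finsler structure. It is a triple $(\phi,\eta,\xi)$ where $\phi$ is a $(1,1)$-tensor field on $E$ with $\phi(HE)\subseteq HE$ and $\phi(VE)\subseteq VE$, $\eta$ is a 1-form on $E$ and $\xi$ is a vector field on $E$, such that $$\phi^2=I-\eta^H\otimes\xi^H-\eta^V\otimes\xi^V,\qquad \eta^H(\xi^H)=\eta^V(\xi^V)=1 .$$ Conventions. $d\omega(X,Y)=X(\omega(Y))-Y(\omega(X))-\omega([X,Y])$ for a 1-form $\omega$. $\pounds^H_X=\pounds_{X^H}$ and $\pounds^V_X=\pounds_{X^V}$ are Lie derivatives along $X^H$, $X^V$; thus $\pounds^H_{\phi X}=\pounds_{\phi X^H}$, $\pounds^V_{\phi X}=\pounds_{\phi X^V}$, $\pounds^H_\xi=\pounds_{\xi^H}$, $\pounds^V_\xi=\pounds_{\xi^V}$. Tensors.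 With $N_\phi(X,Y)=\phi^2[X,Y]+[\phi X,\phi Y]-\phi[\phi X,Y]-\phi[X,\phi Y]$, $$N^{(1)}(X,Y)=N_\phi(X,Y)-d\eta^H(X,Y)\xi^H-d\eta^V(X,Y)\xi^V$$ for all vector fields $X,Y$ on $E$ (the structure is called normal if $N^{(1)}=0$). Further, \begin{align*} N^{(2)}(X^H,Y^H)&=(\pounds^H_{\phi X}\eta^H)(Y^H)-(\pounds^H_{\phi Y}\eta^H)(X^H),\\ N^{(2)}(X^V,Y^V)&=(\pounds^V_{\phi X}\eta^V)(Y^V)-(\pounds^V_{\phi Y}\eta^V)(X^V),\\ N^{(2)}(X^V,Y^H)&=(\pounds^V_{\phi X}\eta^H)(Y^H)+(\pounds^V_{\phi X}\eta^V)(Y^H)-(\pounds^H_{\phi Y}\eta^H)(X^V)-(\pounds^H_{\phi Y}\eta^V)(X^V). \end{align*} $N^{(3)}$ and $N^{(4)}$ each consist of the following four components: (1) $N^{(3)}(X^H)=(\pounds^H_\xi\phi)(X^H)$, $N^{(4)}(X^H)=(\pounds^H_\xi\eta^H)(X^H)$; (2) $N^{(3)}(X^V)=(\pounds^V_\xi\phi)(X^V)$, $N^{(4)}(X^V)=(\pounds^V_\xi\eta^V)(X^V)$; (3) (for $X^H$ and $\xi^V$) $N^{(3)}(X^H)=(\pounds^V_\xi\phi)(X^H)$, $N^{(4)}(X^H)=(\pounds^V_\xi\eta^H)(X^H)$; (4) (for $X^V$ and $\xi^H$) $N^{(3)}(X^V)=(\pounds^H_\xi\phi)(X^V)$, $N^{(4)}(X^V)=(\pounds^H_\xi\eta^V)(X^V)$.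 Vanishing of $N^{(2)}$, $N^{(3)}$, $N^{(4)}$ means vanishing of all listed components for all vector fields $X,Y$. *)

theory Defs
  imports "HOL-Analysis.Analysis" "HOL-Library.Function_Algebras"
begin

instantiation "fun" :: (type, real_vector) real_vector
begin

definition scaleR_fun_def: "c *\<^sub>R f = (\<lambda>x. c *\<^sub>R f x)"

instance
  by standard (auto simp: scaleR_fun_def fun_eq_iff scaleR_add_right scaleR_add_left)

end

lemma scaleR_fun_apply [simp]: "(c *\<^sub>R f) x = c *\<^sub>R f x"
  by (simp add: scaleR_fun_def)


section \<open>Smooth manifolds\<close>

text \<open>Only used on open sets \<open>S\<close> of Euclidean spaces.\<close>

primrec Ck_on ::
  "nat \<Rightarrow> ('a::euclidean_space \<Rightarrow> 'b::real_normed_vector) \<Rightarrow> 'a set \<Rightarrow> bool" where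
  "Ck_on 0 f S \<longleftrightarrow> continuous_on S f"
| "Ck_on (Suc k) f S \<longleftrightarrow>
     (\<forall>x\<in>S. f differentiable (at x)) \<and>
     (\<forall>v. Ck_on k (\<lambda>x. frechet_derivative f (at x) v) S)"

definition smooth_on :: "'a::euclidean_space set \<Rightarrow> ('a \<Rightarrow> 'b::real_normed_vector) \<Rightarrow> bool" where
  "smooth_on S f \<longleftrightarrow> (\<forall>k. Ck_on k f S)"

type_synonym ('m, 'a) chart = "'m set \<times> ('m \<Rightarrow> 'a)"

definition is_chart :: "('m::topological_space, 'a::euclidean_space) chart \<Rightarrow> bool" where
  "is_chart c \<longleftrightarrow> (case c of (U, \<phi>) \<Rightarrow>
     open U \<and> open (\<phi> ` U) \<and> homeomorphism U (\<phi> ` U) \<phi> (inv_into U \<phi>))"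

text \<open>A smooth manifold is a second countable Hausdorff space, given as a whole type, with
  an atlas. The atlas need not be maximal; all notions below depend only on the smooth
  structure it generates.\<close>

definition smooth_atlas ::
  "('m::{second_countable_topology,t2_space}, 'a::euclidean_space) chart set \<Rightarrow> bool" where
  "smooth_atlas A \<longleftrightarrow>
     (\<forall>c\<in>A. is_chart c) \<and> \<Union>(fst ` A) = UNIV \<and>
     (\<forall>(U, \<phi>)\<in>A. \<forall>(V, \<psi>)\<in>A. smooth_on (\<phi> ` (U \<inter> V)) (\<psi> \<circ> inv_into U \<phi>))"

definition smooth_map_on ::
  "('m::topological_space, 'a::euclidean_space) chart set \<Rightarrow>
   ('n::topological_space, 'b::euclidean_space) chart set \<Rightarrow> 'm set \<Rightarrow> ('m \<Rightarrow> 'n) \<Rightarrow> bool" where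
  "smooth_map_on A B S f \<longleftrightarrow>
     (\<forall>p\<in>S. \<exists>(U, \<phi>)\<in>A. \<exists>(V, \<psi>)\<in>B. \<exists>W.
        open W \<and> p \<in> W \<and> W \<subseteq> S \<inter> U \<and> f ` W \<subseteq> V \<and>
        smooth_on (\<phi> ` W) (\<psi> \<circ> f \<circ> inv_into U \<phi>))"

definition euclidean_atlas :: "('a::euclidean_space, 'a) chart set" where
  "euclidean_atlas = {(UNIV, \<lambda>x. x)}"

definition product_atlas ::
  "('m, 'a) chart set \<Rightarrow> ('n, 'b) chart set \<Rightarrow> ('m \<times> 'n, 'a \<times> 'b) chart set" where
  "product_atlas A B = {(U \<times> V, map_prod \<phi> \<psi>) | U \<phi> V \<psi>. (U, \<phi>) \<in> A \<and> (V, \<psi>) \<in> B}"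

definition diffeomorphism_on ::
  "('m::topological_space, 'a::euclidean_space) chart set \<Rightarrow>
   ('n::topological_space, 'b::euclidean_space) chart set \<Rightarrow>
   'm set \<Rightarrow> 'n set \<Rightarrow> ('m \<Rightarrow> 'n) \<Rightarrow> bool" where
  "diffeomorphism_on A B S T f \<longleftrightarrow>
     open S \<and> open T \<and> bij_betw f S T \<and>
     smooth_map_on A B S f \<and> smooth_map_on B A T (inv_into S f)"

definition smooth_fun_on ::
  "('m::topological_space, 'a::euclidean_space) chart set \<Rightarrow> 'm set \<Rightarrow> ('m \<Rightarrow> real) \<Rightarrow> bool" where
  "smooth_fun_on A S f \<longleftrightarrow> smooth_map_on A euclidean_atlas S f"

abbreviation smooth_fun ::
  "('m::topological_space, 'a::euclidean_space) chart set \<Rightarrow> ('m \<Rightarrow> real) \<Rightarrow> bool" where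
  "smooth_fun A \<equiv> smooth_fun_on A UNIV"


section \<open>Tangent vectors, vector fields and tensor fields\<close>

text \<open>A tangent vector at \<open>p\<close> is a derivation at \<open>p\<close> of the algebra of smooth functions. It is
  extended by \<open>0\<close> to non-smooth functions, so that equality of tangent vectors is equality
  in HOL.\<close>

type_synonym 'm tvec = "('m \<Rightarrow> real) \<Rightarrow> real"

definition tangent_space ::
  "('m::topological_space, 'a::euclidean_space) chart set \<Rightarrow> 'm \<Rightarrow> 'm tvec set" where
  "tangent_space A p = {v.
     (\<forall>f g. smooth_fun A f \<longrightarrow> smooth_fun A g \<longrightarrow> v (f + g) = v f + v g) \<and>
     (\<forall>c f. smooth_fun A f \<longrightarrow> v (c *\<^sub>R f) = c * v f) \<and>
     (\<forall>f g. smooth_fun A f \<longrightarrow> smooth_fun A g \<longrightarrow> v (f * g) = f p * v g + g p * v f) \<and>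
     (\<forall>f. \<not> smooth_fun A f \<longrightarrow> v f = 0)}"

definition differential ::
  "('n::topological_space, 'b::euclidean_space) chart set \<Rightarrow> ('m \<Rightarrow> 'n) \<Rightarrow> 'm tvec \<Rightarrow> 'n tvec" where
  "differential B F v = (\<lambda>g. if smooth_fun B g then v (g \<circ> F) else 0)"

text \<open>A section of the tangent bundle is smooth iff it maps smooth functions to smooth functions,
  and a tensor field is smooth iff it does so on smooth vector fields.\<close>

definition vector_field_on ::
  "('m::topological_space, 'a::euclidean_space) chart set \<Rightarrow> 'm set \<Rightarrow> ('m \<Rightarrow> 'm tvec) \<Rightarrow> bool" where
  "vector_field_on A S X \<longleftrightarrow>
     (\<forall>p\<in>S. X p \<in> tangent_space A p) \<and>
     (\<forall>f. smooth_fun A f \<longrightarrow> smooth_fun_on A S (\<lambda>p. X p f))"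

abbreviation vector_field ::
  "('m::topological_space, 'a::euclidean_space) chart set \<Rightarrow> ('m \<Rightarrow> 'm tvec) \<Rightarrow> bool" where
  "vector_field A \<equiv> vector_field_on A UNIV"

definition linear_on_set ::
  "'v::real_vector set \<Rightarrow> ('v \<Rightarrow> 'w::real_vector) \<Rightarrow> bool" where
  "linear_on_set T L \<longleftrightarrow>
     (\<forall>u\<in>T. \<forall>v\<in>T. L (u + v) = L u + L v) \<and> (\<forall>c. \<forall>v\<in>T. L (c *\<^sub>R v) = c *\<^sub>R L v)"

definition one_form ::
  "('m::topological_space, 'a::euclidean_space) chart set \<Rightarrow> ('m \<Rightarrow> 'm tvec \<Rightarrow> real) \<Rightarrow> bool" where
  "one_form A \<omega> \<longleftrightarrow>
     (\<forall>p. linear_on_set (tangent_space A p) (\<omega> p)) \<and>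
     (\<forall>X. vector_field A X \<longrightarrow> smooth_fun A (\<lambda>p. \<omega> p (X p)))"

definition endomorphism_field ::
  "('m::topological_space, 'a::euclidean_space) chart set \<Rightarrow> ('m \<Rightarrow> 'm tvec \<Rightarrow> 'm tvec) \<Rightarrow> bool" where
  "endomorphism_field A \<phi> \<longleftrightarrow>
     (\<forall>p. linear_on_set (tangent_space A p) (\<phi> p) \<and>
          \<phi> p ` tangent_space A p \<subseteq> tangent_space A p) \<and>
     (\<forall>X. vector_field A X \<longrightarrow> vector_field A (\<lambda>p. \<phi> p (X p)))"

definition lie_bracket :: "('m \<Rightarrow> 'm tvec) \<Rightarrow> ('m \<Rightarrow> 'm tvec) \<Rightarrow> 'm \<Rightarrow> 'm tvec" where
  "lie_bracket X Y = (\<lambda>p f. X p (\<lambda>q. Y q f) - Y p (\<lambda>q. X q f))"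

definition ext_deriv ::
  "('m \<Rightarrow> 'm tvec \<Rightarrow> real) \<Rightarrow> ('m \<Rightarrow> 'm tvec) \<Rightarrow> ('m \<Rightarrow> 'm tvec) \<Rightarrow> 'm \<Rightarrow> real" where
  "ext_deriv \<omega> X Y =
     (\<lambda>p. X p (\<lambda>q. \<omega> q (Y q)) - Y p (\<lambda>q. \<omega> q (X q)) - \<omega> p (lie_bracket X Y p))"

definition lie_form ::
  "('m \<Rightarrow> 'm tvec) \<Rightarrow> ('m \<Rightarrow> 'm tvec \<Rightarrow> real) \<Rightarrow> ('m \<Rightarrow> 'm tvec) \<Rightarrow> 'm \<Rightarrow> real" where
  "lie_form X \<omega> Y = (\<lambda>p. X p (\<lambda>q. \<omega> q (Y q)) - \<omega> p (lie_bracket X Y p))"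

definition lie_endo ::
  "('m \<Rightarrow> 'm tvec) \<Rightarrow> ('m \<Rightarrow> 'm tvec \<Rightarrow> 'm tvec) \<Rightarrow> ('m \<Rightarrow> 'm tvec) \<Rightarrow> 'm \<Rightarrow> 'm tvec" where
  "lie_endo X \<phi> Y = (\<lambda>p. lie_bracket X (\<lambda>q. \<phi> q (Y q)) p - \<phi> p (lie_bracket X Y p))"


section \<open>Vector bundles and nonlinear connections\<close>

text \<open>The operations \<open>vadd\<close> and \<open>scl\<close> are the vector space operations of the fibres. The vector
  space axioms in the fibre over \<open>x\<close> need no separate statement: \<open>h\<close> is injective on the fibre,
  maps it onto \<open>'f\<close>, and carries the operations to those of \<open>'f\<close>.\<close>

definition local_trivialization ::
  "('e::topological_space, 'b::euclidean_space \<times> 'f::euclidean_space) chart set \<Rightarrow>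
   ('m::topological_space, 'b) chart set \<Rightarrow> ('e \<Rightarrow> 'm) \<Rightarrow>
   ('e \<Rightarrow> 'e \<Rightarrow> 'e) \<Rightarrow> (real \<Rightarrow> 'e \<Rightarrow> 'e) \<Rightarrow> 'm set \<Rightarrow> ('e \<Rightarrow> 'f) \<Rightarrow> bool" where
  "local_trivialization atE atM \<pi> vadd scl U h \<longleftrightarrow>
     open U \<and>
     diffeomorphism_on atE (product_atlas atM euclidean_atlas)
       (\<pi> -` U) (U \<times> UNIV) (\<lambda>e. (\<pi> e, h e)) \<and>
     (\<forall>x\<in>U. \<forall>e\<in>\<pi> -` {x}. \<forall>e'\<in>\<pi> -` {x}. \<forall>c.
        \<pi> (vadd e e') = x \<and> h (vadd e e') = h e + h e' \<and>
        \<pi> (scl c e) = x \<and> h (scl c e) = c *\<^sub>R h e)"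

text \<open>The base has dimension \<open>DIM('b)\<close>, the fibres have dimension \<open>DIM('f)\<close>.\<close>

definition smooth_vector_bundle ::
  "('e::{second_countable_topology,t2_space}, 'b::euclidean_space \<times> 'f::euclidean_space) chart set \<Rightarrow>
   ('m::{second_countable_topology,t2_space}, 'b) chart set \<Rightarrow> ('e \<Rightarrow> 'm) \<Rightarrow>
   ('e \<Rightarrow> 'e \<Rightarrow> 'e) \<Rightarrow> (real \<Rightarrow> 'e \<Rightarrow> 'e) \<Rightarrow> bool" where
  "smooth_vector_bundle atE atM \<pi> vadd scl \<longleftrightarrow>
     smooth_atlas atE \<and> smooth_atlas atM \<and> smooth_map_on atE atM UNIV \<pi> \<and> surj \<pi> \<and>
     (\<forall>x. \<exists>U h. x \<in> U \<and> local_trivialization atE atM \<pi> vadd scl U h)"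

definition vertical_bundle ::
  "('e::topological_space, 'a::euclidean_space) chart set \<Rightarrow>
   ('m::topological_space, 'b::euclidean_space) chart set \<Rightarrow> ('e \<Rightarrow> 'm) \<Rightarrow> 'e \<Rightarrow> 'e tvec set" where
  "vertical_bundle atE atM \<pi> p = {v \<in> tangent_space atE p. differential atM \<pi> v = 0}"

definition smooth_distribution ::
  "('m::topological_space, 'a::euclidean_space) chart set \<Rightarrow> ('m \<Rightarrow> 'm tvec set) \<Rightarrow> bool" where
  "smooth_distribution A D \<longleftrightarrow>
     (\<exists>k::nat. \<forall>p. \<exists>U X. open U \<and> p \<in> U \<and>
        (\<forall>i<k. vector_field_on A U (X i)) \<and>
        (\<forall>q\<in>U. inj_on (\<lambda>i. X i q) {..<k} \<and> independent ((\<lambda>i. X i q) ` {..<k}) \<and>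
               D q = span ((\<lambda>i. X i q) ` {..<k})))"

definition nonlinear_connection ::
  "('e::topological_space, 'a::euclidean_space) chart set \<Rightarrow>
   ('m::topological_space, 'b::euclidean_space) chart set \<Rightarrow> ('e \<Rightarrow> 'm) \<Rightarrow>
   ('e \<Rightarrow> 'e tvec set) \<Rightarrow> bool" where
  "nonlinear_connection atE atM \<pi> H \<longleftrightarrow>
     smooth_distribution atE H \<and>
     (\<forall>p. H p \<inter> vertical_bundle atE atM \<pi> p = {0} \<and>
          tangent_space atE p = {h + v | h v. h \<in> H p \<and> v \<in> vertical_bundle atE atM \<pi> p})"

text \<open>For a direct sum \<open>A \<oplus> B\<close>, the component in \<open>A\<close>. Below, \<open>H\<close> and \<open>V\<close> are the horizontal
  and the vertical bundle, so \<open>X\<^sup>H\<close> is \<open>vf_part H V X\<close> and \<open>X\<^sup>V\<close> is \<open>vf_part V H X\<close>.\<close>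

definition proj_along :: "'v::ab_group_add set \<Rightarrow> 'v set \<Rightarrow> 'v \<Rightarrow> 'v" where
  "proj_along A B v = (THE a. a \<in> A \<and> v - a \<in> B)"

definition vf_part ::
  "('e \<Rightarrow> 'e tvec set) \<Rightarrow> ('e \<Rightarrow> 'e tvec set) \<Rightarrow> ('e \<Rightarrow> 'e tvec) \<Rightarrow> 'e \<Rightarrow> 'e tvec" where
  "vf_part H V X = (\<lambda>p. proj_along (H p) (V p) (X p))"

definition form_part ::
  "('e \<Rightarrow> 'e tvec set) \<Rightarrow> ('e \<Rightarrow> 'e tvec set) \<Rightarrow> ('e \<Rightarrow> 'e tvec \<Rightarrow> real) \<Rightarrow> 'e \<Rightarrow> 'e tvec \<Rightarrow> real" where
  "form_part H V \<omega> = (\<lambda>p v. \<omega> p (proj_along (H p) (V p) v))"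


section \<open>Almost paracontact Finsler structures\<close>

definition almost_paracontact_finsler ::
  "('e::topological_space, 'a::euclidean_space) chart set \<Rightarrow>
   ('e \<Rightarrow> 'e tvec set) \<Rightarrow> ('e \<Rightarrow> 'e tvec set) \<Rightarrow>
   ('e \<Rightarrow> 'e tvec \<Rightarrow> 'e tvec) \<Rightarrow> ('e \<Rightarrow> 'e tvec \<Rightarrow> real) \<Rightarrow> ('e \<Rightarrow> 'e tvec) \<Rightarrow> bool" where
  "almost_paracontact_finsler atE H V \<phi> \<eta> \<xi> \<longleftrightarrow>
     endomorphism_field atE \<phi> \<and> one_form atE \<eta> \<and> vector_field atE \<xi> \<and>
     (\<forall>p. \<phi> p ` H p \<subseteq> H p \<and> \<phi> p ` V p \<subseteq> V p) \<and>
     (\<forall>p. \<forall>v\<in>tangent_space atE p.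
        \<phi> p (\<phi> p v) = v - form_part H V \<eta> p v *\<^sub>R vf_part H V \<xi> p
                         - form_part V H \<eta> p v *\<^sub>R vf_part V H \<xi> p) \<and>
     (\<forall>p. form_part H V \<eta> p (vf_part H V \<xi> p) = 1 \<and>
          form_part V H \<eta> p (vf_part V H \<xi> p) = 1)"

definition nijenhuis ::
  "('e \<Rightarrow> 'e tvec \<Rightarrow> 'e tvec) \<Rightarrow> ('e \<Rightarrow> 'e tvec) \<Rightarrow> ('e \<Rightarrow> 'e tvec) \<Rightarrow> 'e \<Rightarrow> 'e tvec" where
  "nijenhuis \<phi> X Y = (\<lambda>p.
     \<phi> p (\<phi> p (lie_bracket X Y p))
     + lie_bracket (\<lambda>q. \<phi> q (X q)) (\<lambda>q. \<phi> q (Y q)) p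
     - \<phi> p (lie_bracket (\<lambda>q. \<phi> q (X q)) Y p)
     - \<phi> p (lie_bracket X (\<lambda>q. \<phi> q (Y q)) p))"

definition N1 ::
  "('e \<Rightarrow> 'e tvec set) \<Rightarrow> ('e \<Rightarrow> 'e tvec set) \<Rightarrow>
   ('e \<Rightarrow> 'e tvec \<Rightarrow> 'e tvec) \<Rightarrow> ('e \<Rightarrow> 'e tvec \<Rightarrow> real) \<Rightarrow> ('e \<Rightarrow> 'e tvec) \<Rightarrow>
   ('e \<Rightarrow> 'e tvec) \<Rightarrow> ('e \<Rightarrow> 'e tvec) \<Rightarrow> 'e \<Rightarrow> 'e tvec" where
  "N1 H V \<phi> \<eta> \<xi> X Y = (\<lambda>p. nijenhuis \<phi> X Y p
     - ext_deriv (form_part H V \<eta>) X Y p *\<^sub>R vf_part H V \<xi> p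
     - ext_deriv (form_part V H \<eta>) X Y p *\<^sub>R vf_part V H \<xi> p)"

definition N2_HH ::
  "('e \<Rightarrow> 'e tvec set) \<Rightarrow> ('e \<Rightarrow> 'e tvec set) \<Rightarrow>
   ('e \<Rightarrow> 'e tvec \<Rightarrow> 'e tvec) \<Rightarrow> ('e \<Rightarrow> 'e tvec \<Rightarrow> real) \<Rightarrow>
   ('e \<Rightarrow> 'e tvec) \<Rightarrow> ('e \<Rightarrow> 'e tvec) \<Rightarrow> 'e \<Rightarrow> real" where
  "N2_HH H V \<phi> \<eta> X Y =
     lie_form (\<lambda>q. \<phi> q (vf_part H V X q)) (form_part H V \<eta>) (vf_part H V Y)
     - lie_form (\<lambda>q. \<phi> q (vf_part H V Y q)) (form_part H V \<eta>) (vf_part H V X)"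

definition N2_VV ::
  "('e \<Rightarrow> 'e tvec set) \<Rightarrow> ('e \<Rightarrow> 'e tvec set) \<Rightarrow>
   ('e \<Rightarrow> 'e tvec \<Rightarrow> 'e tvec) \<Rightarrow> ('e \<Rightarrow> 'e tvec \<Rightarrow> real) \<Rightarrow>
   ('e \<Rightarrow> 'e tvec) \<Rightarrow> ('e \<Rightarrow> 'e tvec) \<Rightarrow> 'e \<Rightarrow> real" where
  "N2_VV H V \<phi> \<eta> X Y =
     lie_form (\<lambda>q. \<phi> q (vf_part V H X q)) (form_part V H \<eta>) (vf_part V H Y)
     - lie_form (\<lambda>q. \<phi> q (vf_part V H Y q)) (form_part V H \<eta>) (vf_part V H X)"

definition N2_VH ::
  "('e \<Rightarrow> 'e tvec set) \<Rightarrow> ('e \<Rightarrow> 'e tvec set) \<Rightarrow>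
   ('e \<Rightarrow> 'e tvec \<Rightarrow> 'e tvec) \<Rightarrow> ('e \<Rightarrow> 'e tvec \<Rightarrow> real) \<Rightarrow>
   ('e \<Rightarrow> 'e tvec) \<Rightarrow> ('e \<Rightarrow> 'e tvec) \<Rightarrow> 'e \<Rightarrow> real" where
  "N2_VH H V \<phi> \<eta> X Y =
     lie_form (\<lambda>q. \<phi> q (vf_part V H X q)) (form_part H V \<eta>) (vf_part H V Y)
     + lie_form (\<lambda>q. \<phi> q (vf_part V H X q)) (form_part V H \<eta>) (vf_part H V Y)
     - lie_form (\<lambda>q. \<phi> q (vf_part H V Y q)) (form_part H V \<eta>) (vf_part V H X)
     - lie_form (\<lambda>q. \<phi> q (vf_part H V Y q)) (form_part V H \<eta>) (vf_part V H X)"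

text \<open>The letters name the part of \<open>X\<close>, then the part of \<open>\<xi>\<close>.\<close>

definition N3_HH ::
  "('e \<Rightarrow> 'e tvec set) \<Rightarrow> ('e \<Rightarrow> 'e tvec set) \<Rightarrow> ('e \<Rightarrow> 'e tvec \<Rightarrow> 'e tvec) \<Rightarrow>
   ('e \<Rightarrow> 'e tvec) \<Rightarrow> ('e \<Rightarrow> 'e tvec) \<Rightarrow> 'e \<Rightarrow> 'e tvec" where
  "N3_HH H V \<phi> \<xi> X = lie_endo (vf_part H V \<xi>) \<phi> (vf_part H V X)"

definition N3_VV ::
  "('e \<Rightarrow> 'e tvec set) \<Rightarrow> ('e \<Rightarrow> 'e tvec set) \<Rightarrow> ('e \<Rightarrow> 'e tvec \<Rightarrow> 'e tvec) \<Rightarrow>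
   ('e \<Rightarrow> 'e tvec) \<Rightarrow> ('e \<Rightarrow> 'e tvec) \<Rightarrow> 'e \<Rightarrow> 'e tvec" where
  "N3_VV H V \<phi> \<xi> X = lie_endo (vf_part V H \<xi>) \<phi> (vf_part V H X)"

definition N3_HV ::
  "('e \<Rightarrow> 'e tvec set) \<Rightarrow> ('e \<Rightarrow> 'e tvec set) \<Rightarrow> ('e \<Rightarrow> 'e tvec \<Rightarrow> 'e tvec) \<Rightarrow>
   ('e \<Rightarrow> 'e tvec) \<Rightarrow> ('e \<Rightarrow> 'e tvec) \<Rightarrow> 'e \<Rightarrow> 'e tvec" where
  "N3_HV H V \<phi> \<xi> X = lie_endo (vf_part V H \<xi>) \<phi> (vf_part H V X)"

definition N3_VH ::
  "('e \<Rightarrow> 'e tvec set) \<Rightarrow> ('e \<Rightarrow> 'e tvec set) \<Rightarrow> ('e \<Rightarrow> 'e tvec \<Rightarrow> 'e tvec) \<Rightarrow>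
   ('e \<Rightarrow> 'e tvec) \<Rightarrow> ('e \<Rightarrow> 'e tvec) \<Rightarrow> 'e \<Rightarrow> 'e tvec" where
  "N3_VH H V \<phi> \<xi> X = lie_endo (vf_part H V \<xi>) \<phi> (vf_part V H X)"

definition N4_HH ::
  "('e \<Rightarrow> 'e tvec set) \<Rightarrow> ('e \<Rightarrow> 'e tvec set) \<Rightarrow> ('e \<Rightarrow> 'e tvec \<Rightarrow> real) \<Rightarrow>
   ('e \<Rightarrow> 'e tvec) \<Rightarrow> ('e \<Rightarrow> 'e tvec) \<Rightarrow> 'e \<Rightarrow> real" where
  "N4_HH H V \<eta> \<xi> X = lie_form (vf_part H V \<xi>) (form_part H V \<eta>) (vf_part H V X)"

definition N4_VV ::
  "('e \<Rightarrow> 'e tvec set) \<Rightarrow> ('e \<Rightarrow> 'e tvec set) \<Rightarrow> ('e \<Rightarrow> 'e tvec \<Rightarrow> real) \<Rightarrow>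
   ('e \<Rightarrow> 'e tvec) \<Rightarrow> ('e \<Rightarrow> 'e tvec) \<Rightarrow> 'e \<Rightarrow> real" where
  "N4_VV H V \<eta> \<xi> X = lie_form (vf_part V H \<xi>) (form_part V H \<eta>) (vf_part V H X)"

definition N4_HV ::
  "('e \<Rightarrow> 'e tvec set) \<Rightarrow> ('e \<Rightarrow> 'e tvec set) \<Rightarrow> ('e \<Rightarrow> 'e tvec \<Rightarrow> real) \<Rightarrow>
   ('e \<Rightarrow> 'e tvec) \<Rightarrow> ('e \<Rightarrow> 'e tvec) \<Rightarrow> 'e \<Rightarrow> real" where
  "N4_HV H V \<eta> \<xi> X = lie_form (vf_part V H \<xi>) (form_part H V \<eta>) (vf_part H V X)"

definition N4_VH ::
  "('e \<Rightarrow> 'e tvec set) \<Rightarrow> ('e \<Rightarrow> 'e tvec set) \<Rightarrow> ('e \<Rightarrow> 'e tvec \<Rightarrow> real) \<Rightarrow>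
   ('e \<Rightarrow> 'e tvec) \<Rightarrow> ('e \<Rightarrow> 'e tvec) \<Rightarrow> 'e \<Rightarrow> real" where
  "N4_VH H V \<eta> \<xi> X = lie_form (vf_part H V \<xi>) (form_part V H \<eta>) (vf_part V H X)"

end

theory Submission
  imports Defs
begin

text \<open>
  Write \<open>\<alpha> = \<eta>\<^sup>H\<close>, \<open>\<beta> = \<eta>\<^sup>V\<close>. Since \<open>\<phi>\<close> preserves the horizontal bundle, \<open>0 = \<phi>\<^sup>3 \<xi>\<^sup>H = \<phi> \<xi>\<^sup>H - a \<xi>\<^sup>H\<close>
  for some function \<open>a\<close>, and applying \<open>\<phi>\<close> once more gives \<open>a \<phi> \<xi>\<^sup>H = 0\<close>, so \<open>\<phi> \<xi>\<^sup>H = 0\<close>. In the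
  same way \<open>\<phi> \<xi>\<^sup>V = 0\<close>, and then \<open>\<alpha> \<circ> \<phi> = \<beta> \<circ> \<phi> = 0\<close>. Thus \<open>(\<alpha>, \<xi>\<^sup>H)\<close> and
  \<open>(\<beta>, \<xi>\<^sup>V)\<close> are two dual pairs that enter symmetrically
  (locale \<open>normal_paracontact_frame\<close>), and everything follows by evaluating the normality
  equation on suitable smooth fields.

  Applying \<open>\<alpha>\<close> to \<open>N\<^sup>(\<^sup>1\<^sup>)(X, Y) = 0\<close> leaves \<open>\<alpha>[\<phi>X, \<phi>Y] = d\<alpha>(X, Y)\<close>
  (\<open>bracket_phi_phi\<close>). For \<open>Y\<close> one of the two distinguished fields the left side vanishes, and
  the vanishing right side is, up to sign, the Lie derivative of \<open>\<alpha>\<close> along that field: this is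
  \<open>N\<^sup>(\<^sup>4\<^sup>) = 0\<close>. With the \<open>d\<alpha>\<close> and \<open>d\<beta>\<close> terms gone, normality says that
  \<open>W = \<phi>[X, \<xi>] - [\<phi>X, \<xi>]\<close> is in the kernel of \<open>\<phi>\<close>; it is also in the kernels of
  \<open>\<alpha>\<close> and \<open>\<beta>\<close>, so it is zero, which is \<open>N\<^sup>(\<^sup>3\<^sup>) = 0\<close>. Replacing \<open>X\<close> by
  \<open>\<phi>X\<close> in \<open>bracket_phi_phi\<close> and expanding \<open>\<phi>\<^sup>2X\<close> by the Leibniz rule gives
  \<open>N\<^sup>(\<^sup>2\<^sup>) = 0\<close> (\<open>lie_form_phi_symmetric\<close>).

  Normality is a statement about smooth fields only, so these evaluations need \<open>X\<^sup>H\<close>,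
  \<open>X\<^sup>V\<close>, \<open>\<xi>\<^sup>H\<close> and \<open>\<xi>\<^sup>V\<close> to be smooth. This is the analytic part of the proof
  (\<open>smooth_near_horizontal_part\<close>). In a local frame \<open>Y\<^sub>i\<close> of the horizontal distribution let
  \<open>X\<^sup>H = \<Sum> c\<^sub>i Y\<^sub>i\<close>. Vertical vectors kill functions pulled back from the base, so
  \<open>\<Sum> c\<^sub>i Y\<^sub>i(g \<circ> \<pi>) = X(g \<circ> \<pi>)\<close> for every smooth \<open>g\<close> on the base. Because no nonzero horizontal
  vector is vertical, there are functions \<open>g\<^sub>j\<close> for which the matrix
  \<open>Y\<^sub>i(g\<^sub>j \<circ> \<pi>)\<close> is the identity at a given point; hence the smooth linear system for the \<open>c\<^sub>i\<close>
  can be solved near that point, and the solution is smooth.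
\<close>

section \<open>Calculus of continuously differentiable functions\<close>

lemma frechet_derivative_cong_open:
  assumes "open S" "x \<in> S" "\<And>y. y \<in> S \<Longrightarrow> f y = g y"
  shows "frechet_derivative f (at x) = frechet_derivative g (at x)"
proof -
  have "(f has_derivative D) (at x) \<longleftrightarrow> (g has_derivative D) (at x)" for D
    using assms has_derivative_transform_within_open by metis
  then show ?thesis by (simp add: frechet_derivative_def)
qed

lemma Ck_on_cong:
  assumes "open S" "\<And>y. y \<in> S \<Longrightarrow> f y = g y" "Ck_on k f S"
  shows "Ck_on k g S"
  using assms(2,3)
proof (induction k arbitrary: f g)
  case 0
  then show ?case using continuous_on_cong by force
next
  case (Suc k)
  have "g differentiable (at x)" if "x \<in> S" for x
    using Suc.prems that assms(1) has_derivative_transform_within_open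
    unfolding differentiable_def Ck_on.simps by metis
  moreover have "Ck_on k (\<lambda>x. frechet_derivative g (at x) v) S" for v
  proof (rule Suc.IH)
    show "Ck_on k (\<lambda>x. frechet_derivative f (at x) v) S" using Suc.prems by simp
    show "frechet_derivative f (at y) v = frechet_derivative g (at y) v" if "y \<in> S" for y
      using frechet_derivative_cong_open[OF assms(1) that] Suc.prems(1) by metis
  qed
  ultimately show ?case by simp
qed

lemma Ck_on_subset: "Ck_on k f S \<Longrightarrow> T \<subseteq> S \<Longrightarrow> Ck_on k f T"
  by (induction k arbitrary: f) (auto intro: continuous_on_subset)

lemma Ck_on_Suc_imp: "Ck_on (Suc k) f S \<Longrightarrow> Ck_on k f S"
proof (induction k arbitrary: f)
  case 0
  then show ?case
    by (auto intro!: continuous_at_imp_continuous_on differentiable_imp_continuous_within)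
next
  case (Suc k)
  then show ?case by simp
qed

text \<open>Any pointwise formula for the derivative may replace the chosen Frechet derivative. Each
  closure property below is then an induction on the order of differentiability whose step is the
  corresponding differentiation rule.\<close>

lemma Ck_on_SucI:
  assumes "open S" "\<And>x. x \<in> S \<Longrightarrow> (f has_derivative D x) (at x)"
    and "\<And>v. Ck_on k (\<lambda>x. D x v) S"
  shows "Ck_on (Suc k) f S"
proof -
  have "f differentiable (at x)" if "x \<in> S" for x
    using assms(2)[OF that] differentiable_def by blast
  moreover have "Ck_on k (\<lambda>x. frechet_derivative f (at x) v) S" for v
  proof (rule Ck_on_cong[OF assms(1) _ assms(3)[of v]])
    show "D y v = frechet_derivative f (at y) v" if "y \<in> S" for y
      using frechet_derivative_at[OF assms(2)[OF that]] by simp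
  qed
  ultimately show ?thesis by simp
qed

lemma Ck_on_SucD:
  assumes "Ck_on (Suc k) f S" "x \<in> S"
  shows "(f has_derivative frechet_derivative f (at x)) (at x)"
  using assms frechet_derivative_works by auto

lemma Ck_on_const: "open S \<Longrightarrow> Ck_on k (\<lambda>x. c) S"
proof (induction k arbitrary: c)
  case (Suc k)
  show ?case
    by (rule Ck_on_SucI[where D = "\<lambda>_ _. 0"]) (use Suc in auto)
qed auto

lemma Ck_on_add:
  assumes "open S" "Ck_on k f S" "Ck_on k g S"
  shows "Ck_on k (\<lambda>x. f x + g x) S"
  using assms(2,3)
proof (induction k arbitrary: f g)
  case (Suc k)
  show ?case
    by (rule Ck_on_SucI[OF assms(1), where
          D = "\<lambda>x v. frechet_derivative f (at x) v + frechet_derivative g (at x) v"])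
       (use Suc in \<open>auto intro!: has_derivative_add Ck_on_SucD\<close>)
qed (auto intro: continuous_intros)

lemma Ck_on_bounded_linear:
  assumes "open S" "bounded_linear L" "Ck_on k f S"
  shows "Ck_on k (\<lambda>x. L (f x)) S"
  using assms(3)
proof (induction k arbitrary: f)
  case 0
  then show ?case
    using bounded_linear.continuous_on[OF assms(2)] by simp
next
  case (Suc k)
  show ?case
    by (rule Ck_on_SucI[OF assms(1), where D = "\<lambda>x v. L (frechet_derivative f (at x) v)"])
       (use Suc in \<open>auto intro!: bounded_linear.has_derivative[OF assms(2)] Ck_on_SucD\<close>)
qed

lemma Ck_on_scaleR:
  assumes "open S" "Ck_on k f S" "Ck_on k g S"
  shows "Ck_on k (\<lambda>x. f x *\<^sub>R g x) S"
  using assms(2,3)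
proof (induction k arbitrary: f g)
  case (Suc k)
  show ?case
  proof (rule Ck_on_SucI[OF assms(1)])
    show "((\<lambda>x. f x *\<^sub>R g x) has_derivative
        (\<lambda>v. f x *\<^sub>R frechet_derivative g (at x) v + frechet_derivative f (at x) v *\<^sub>R g x)) (at x)"
      if "x \<in> S" for x
      by (intro has_derivative_scaleR Ck_on_SucD[OF Suc.prems(1) that]
          Ck_on_SucD[OF Suc.prems(2) that])
    show "Ck_on k (\<lambda>x. f x *\<^sub>R frechet_derivative g (at x) v
        + frechet_derivative f (at x) v *\<^sub>R g x) S" for v
      using Suc Ck_on_Suc_imp by (intro Ck_on_add[OF assms(1)] Suc.IH) (auto intro: Ck_on_Suc_imp)
  qed
qed (auto intro: continuous_intros)

lemma Ck_on_mult:
  fixes f g :: "'a::euclidean_space \<Rightarrow> real"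
  assumes "open S" "Ck_on k f S" "Ck_on k g S"
  shows "Ck_on k (\<lambda>x. f x * g x) S"
  using Ck_on_scaleR[OF assms] by simp

lemma Ck_on_sum:
  assumes "open S" "\<And>i. i \<in> I \<Longrightarrow> Ck_on k (f i) S"
  shows "Ck_on k (\<lambda>x. \<Sum>i\<in>I. f i x) S"
  using assms(2)
  by (induction I rule: infinite_finite_induct)
     (auto intro: Ck_on_const[OF assms(1)] Ck_on_add[OF assms(1)])

lemma Ck_on_inverse:
  fixes f :: "'a::euclidean_space \<Rightarrow> real"
  assumes "open S" "Ck_on k f S" "\<And>x. x \<in> S \<Longrightarrow> f x \<noteq> 0"
  shows "Ck_on k (\<lambda>x. inverse (f x)) S"
  using assms(2,3)
proof (induction k arbitrary: f)
  case (Suc k)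
  show ?case
  proof (rule Ck_on_SucI[OF assms(1)])
    show "((\<lambda>x. inverse (f x)) has_derivative
        (\<lambda>v. - (inverse (f x) *\<^sub>R frechet_derivative f (at x) v *\<^sub>R inverse (f x)))) (at x)"
      if "x \<in> S" for x
      using Deriv.has_derivative_inverse[OF Suc.prems(2)[OF that] Ck_on_SucD[OF Suc.prems(1) that]]
      by (simp add: mult.assoc)
    show "Ck_on k (\<lambda>x. - (inverse (f x) *\<^sub>R frechet_derivative f (at x) v *\<^sub>R inverse (f x))) S" for v
      using Suc
      by (intro Ck_on_bounded_linear[OF assms(1) bounded_linear_minus[OF bounded_linear_ident]]
          Ck_on_scaleR[OF assms(1)] Suc.IH) (auto intro: Ck_on_Suc_imp)
  qed
qed (auto intro!: continuous_intros)

text \<open>Expanding the inner derivative in the standard basis turns the chain rule into a sum of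
  products: the first factor is a coordinate of the derivative of \<open>f\<close>, and the second is a partial
  derivative of \<open>g\<close> composed with \<open>f\<close>, to which the induction hypothesis applies.\<close>

lemma Ck_on_compose:
  fixes f :: "'a::euclidean_space \<Rightarrow> 'b::euclidean_space"
  assumes "open S" "open T" "f ` S \<subseteq> T" "Ck_on k f S" "Ck_on k g T"
  shows "Ck_on k (\<lambda>x. g (f x)) S"
  using assms(3-5)
proof (induction k arbitrary: g)
  case 0
  then show ?case by (auto intro: continuous_on_compose2)
next
  case (Suc k)
  let ?Df = "\<lambda>x. frechet_derivative f (at x)" and ?Dg = "\<lambda>y. frechet_derivative g (at y)"
  show ?case
  proof (rule Ck_on_SucI[OF assms(1)])
    fix x assume x: "x \<in> S"
    have f: "(f has_derivative ?Df x) (at x)" using Ck_on_SucD[OF Suc.prems(2) x] .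
    have g: "(g has_derivative ?Dg (f x)) (at (f x))"
      using Ck_on_SucD[OF Suc.prems(3)] x Suc.prems(1) by blast
    have lin: "linear (?Dg (f x))" using g has_derivative_linear by blast
    have "?Dg (f x) (?Df x v) = (\<Sum>b\<in>Basis. (?Df x v \<bullet> b) *\<^sub>R ?Dg (f x) b)" for v
    proof -
      have "?Dg (f x) (?Df x v) = ?Dg (f x) (\<Sum>b\<in>Basis. (?Df x v \<bullet> b) *\<^sub>R b)"
        by (simp add: euclidean_representation)
      also have "\<dots> = (\<Sum>b\<in>Basis. (?Df x v \<bullet> b) *\<^sub>R ?Dg (f x) b)"
        by (simp add: linear_sum[OF lin] linear_scale[OF lin])
      finally show ?thesis .
    qed
    then show "((\<lambda>x. g (f x)) has_derivative
        (\<lambda>v. \<Sum>b\<in>Basis. (?Df x v \<bullet> b) *\<^sub>R ?Dg (f x) b)) (at x)"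
      using has_derivative_compose[OF f g] by simp
  next
    fix v
    show "Ck_on k (\<lambda>x. \<Sum>b\<in>Basis. (?Df x v \<bullet> b) *\<^sub>R ?Dg (f x) b) S"
    proof (intro Ck_on_sum[OF assms(1)] Ck_on_scaleR[OF assms(1)])
      fix b
      show "Ck_on k (\<lambda>x. ?Df x v \<bullet> b) S"
        using Suc.prems(2) by (intro Ck_on_bounded_linear[OF assms(1) bounded_linear_inner_left]) simp
      show "Ck_on k (\<lambda>x. ?Dg (f x) b) S"
        using Suc.prems by (intro Suc.IH Ck_on_Suc_imp[OF Suc.prems(2)]) auto
    qed
  qed
qed

lemma smooth_on_subset: "smooth_on S f \<Longrightarrow> T \<subseteq> S \<Longrightarrow> smooth_on T f"
  unfolding smooth_on_def using Ck_on_subset by blast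

section \<open>Germs of smooth functions on a manifold\<close>

definition smooth_near ::
  "('m::topological_space, 'a::euclidean_space) chart set \<Rightarrow> 'm \<Rightarrow> ('m \<Rightarrow> real) \<Rightarrow> bool" where
  "smooth_near A p f \<longleftrightarrow> (\<exists>W. open W \<and> p \<in> W \<and> smooth_fun_on A W f)"

lemma smooth_fun_on_chart:
  "smooth_fun_on A S f \<longleftrightarrow>
     (\<forall>p\<in>S. \<exists>(U, \<phi>)\<in>A. \<exists>W. open W \<and> p \<in> W \<and> W \<subseteq> S \<inter> U \<and> smooth_on (\<phi> ` W) (f \<circ> inv_into U \<phi>))"
  unfolding smooth_fun_on_def smooth_map_on_def euclidean_atlas_def
  by (simp add: comp_def)

lemma smooth_fun_on_iff_near:
  assumes "open S"
  shows "smooth_fun_on A S f \<longleftrightarrow> (\<forall>p\<in>S. smooth_near A p f)"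
proof
  show "\<forall>p\<in>S. smooth_near A p f" if "smooth_fun_on A S f"
    using that assms smooth_near_def by blast
next
  assume near: "\<forall>p\<in>S. smooth_near A p f"
  show "smooth_fun_on A S f"
    unfolding smooth_fun_on_chart
  proof
    fix p assume p: "p \<in> S"
    with near obtain W where W: "open W" "p \<in> W" "smooth_fun_on A W f"
      unfolding smooth_near_def by blast
    then obtain U \<phi> W' where c: "(U, \<phi>) \<in> A" "open W'" "p \<in> W'" "W' \<subseteq> W \<inter> U"
        "smooth_on (\<phi> ` W') (f \<circ> inv_into U \<phi>)"
      unfolding smooth_fun_on_chart by blast
    have "smooth_on (\<phi> ` (W' \<inter> S)) (f \<circ> inv_into U \<phi>)"
      by (rule smooth_on_subset[OF c(5)]) auto
    moreover have "open (W' \<inter> S)" "p \<in> W' \<inter> S" "W' \<inter> S \<subseteq> S \<inter> U" using c p assms by auto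
    ultimately show "\<exists>(U, \<phi>)\<in>A. \<exists>W. open W \<and> p \<in> W \<and> W \<subseteq> S \<inter> U \<and>
        smooth_on (\<phi> ` W) (f \<circ> inv_into U \<phi>)"
      using c(1) by (intro bexI[of _ "(U, \<phi>)"]) auto
  qed
qed

lemma chart_image_open:
  assumes "is_chart (U, \<phi>)" "open W" "W \<subseteq> U"
  shows "open (\<phi> ` W)"
proof -
  have hom: "homeomorphism U (\<phi> ` U) \<phi> (inv_into U \<phi>)" and "open (\<phi> ` U)"
    using assms(1) by (auto simp: is_chart_def)
  moreover have "openin (top_of_set (\<phi> ` U)) (\<phi> ` W)"
    using homeomorphism_imp_open_map[OF hom] assms open_subset by blast
  ultimately show ?thesis using openin_open_trans by blast
qed

lemma chart_inverse:
  assumes "is_chart (U, \<phi>)" "x \<in> U"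
  shows "inv_into U \<phi> (\<phi> x) = x"
  using assms unfolding is_chart_def homeomorphism_def by auto

locale smooth_manifold =
  fixes A :: "('m::{second_countable_topology,t2_space}, 'a::euclidean_space) chart set"
  assumes atlas: "smooth_atlas A"
begin

lemma chart: "(U, \<phi>) \<in> A \<Longrightarrow> is_chart (U, \<phi>)"
  using atlas unfolding smooth_atlas_def by blast

lemma chart_at: obtains U \<phi> where "(U, \<phi>) \<in> A" "p \<in> U"
  using atlas unfolding smooth_atlas_def by (metis UN_E UNIV_I prod.collapse)

text \<open>Smoothness near a point can be tested in any chart around it, by the chain rule applied to
  the change of coordinates.\<close>

lemma smooth_near_chart:
  assumes c: "(V, \<psi>) \<in> A" "p \<in> V"
  shows "smooth_near A p f \<longleftrightarrow>
    (\<exists>W. open W \<and> p \<in> W \<and> W \<subseteq> V \<and> smooth_on (\<psi> ` W) (f \<circ> inv_into V \<psi>))"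
proof
  assume "smooth_near A p f"
  then obtain U \<phi> W where U: "(U, \<phi>) \<in> A" "open W" "p \<in> W" "W \<subseteq> U"
      "smooth_on (\<phi> ` W) (f \<circ> inv_into U \<phi>)"
    unfolding smooth_near_def smooth_fun_on_chart by blast
  have cU: "is_chart (U, \<phi>)" and cV: "is_chart (V, \<psi>)" using chart U(1) c(1) by auto
  have oV: "open V" using cV by (simp add: is_chart_def)
  let ?W = "W \<inter> V"
  have open_im: "open (\<psi> ` ?W)" "open (\<phi> ` W)"
    using chart_image_open[OF cV, of ?W] chart_image_open[OF cU, of W] U oV by auto
  have "Ck_on k (f \<circ> inv_into V \<psi>) (\<psi> ` ?W)" for k
  proof (rule Ck_on_cong[OF open_im(1)])
    have tr: "smooth_on (\<psi> ` (V \<inter> U)) (\<phi> \<circ> inv_into V \<psi>)"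
      using atlas U(1) c(1) unfolding smooth_atlas_def by blast
    show "Ck_on k (\<lambda>x. (f \<circ> inv_into U \<phi>) ((\<phi> \<circ> inv_into V \<psi>) x)) (\<psi> ` ?W)"
    proof (rule Ck_on_compose[OF open_im])
      show "(\<phi> \<circ> inv_into V \<psi>) ` \<psi> ` ?W \<subseteq> \<phi> ` W" using chart_inverse[OF cV] by auto
      show "Ck_on k (\<phi> \<circ> inv_into V \<psi>) (\<psi> ` ?W)"
        using smooth_on_subset[OF tr, of "\<psi> ` ?W"] U(4) by (auto simp: smooth_on_def)
      show "Ck_on k (f \<circ> inv_into U \<phi>) (\<phi> ` W)" using U(5) by (simp add: smooth_on_def)
    qed
    show "(f \<circ> inv_into U \<phi>) ((\<phi> \<circ> inv_into V \<psi>) y) = (f \<circ> inv_into V \<psi>) y"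
      if "y \<in> \<psi> ` ?W" for y
      using that chart_inverse[OF cV] chart_inverse[OF cU] U(4) by auto
  qed
  then show "\<exists>W. open W \<and> p \<in> W \<and> W \<subseteq> V \<and> smooth_on (\<psi> ` W) (f \<circ> inv_into V \<psi>)"
    using U c(2) oV by (intro exI[of _ ?W]) (auto simp: smooth_on_def)
next
  assume "\<exists>W. open W \<and> p \<in> W \<and> W \<subseteq> V \<and> smooth_on (\<psi> ` W) (f \<circ> inv_into V \<psi>)"
  then obtain W where W: "open W" "p \<in> W" "W \<subseteq> V" "smooth_on (\<psi> ` W) (f \<circ> inv_into V \<psi>)" by blast
  have "smooth_fun_on A W f"
    unfolding smooth_fun_on_chart
    using c(1) W by (intro ballI bexI[of _ "(V, \<psi>)"]) auto
  then show "smooth_near A p f" using W smooth_near_def by blast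
qed

text \<open>In a fixed chart around the point both functions are smooth on a common coordinate domain,
  where the operation can be treated on Euclidean space.\<close>

lemma smooth_near_binop:
  assumes "smooth_near A p f" "smooth_near A p g"
    and op: "\<And>S u v k. open (S::'a set) \<Longrightarrow> Ck_on k u S \<Longrightarrow> Ck_on k v S \<Longrightarrow> Ck_on k (\<lambda>x. opr (u x) (v x)) S"
  shows "smooth_near A p (\<lambda>q. opr (f q) (g q))"
proof -
  obtain V \<psi> where c: "(V, \<psi>) \<in> A" "p \<in> V" using chart_at .
  obtain W1 where W1: "open W1" "p \<in> W1" "W1 \<subseteq> V" "smooth_on (\<psi> ` W1) (f \<circ> inv_into V \<psi>)"
    using assms(1) smooth_near_chart[OF c] by blast
  obtain W2 where W2: "open W2" "p \<in> W2" "W2 \<subseteq> V" "smooth_on (\<psi> ` W2) (g \<circ> inv_into V \<psi>)"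
    using assms(2) smooth_near_chart[OF c] by blast
  let ?W = "W1 \<inter> W2"
  have "open (\<psi> ` ?W)" using chart_image_open[OF chart[OF c(1)]] W1 W2 by blast
  then have "smooth_on (\<psi> ` ?W) ((\<lambda>q. opr (f q) (g q)) \<circ> inv_into V \<psi>)"
    using W1(4) W2(4) op[of "\<psi> ` ?W" _ "f \<circ> inv_into V \<psi>" "g \<circ> inv_into V \<psi>"]
    unfolding smooth_on_def comp_def by (blast intro: Ck_on_subset)
  then show ?thesis
    using W1 W2 by (intro iffD2[OF smooth_near_chart[OF c]] exI[of _ ?W]) auto
qed

lemma smooth_near_add:
  "smooth_near A p f \<Longrightarrow> smooth_near A p g \<Longrightarrow> smooth_near A p (\<lambda>q. f q + g q)"
  by (rule smooth_near_binop) (auto intro: Ck_on_add)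

lemma smooth_near_mult:
  "smooth_near A p f \<Longrightarrow> smooth_near A p g \<Longrightarrow> smooth_near A p (\<lambda>q. f q * g q)"
  by (rule smooth_near_binop) (auto intro: Ck_on_mult)

lemma smooth_near_const: "smooth_near A p (\<lambda>q. c)"
proof -
  obtain V \<psi> where c: "(V, \<psi>) \<in> A" "p \<in> V" using chart_at .
  have "open V" "open (\<psi> ` V)" using chart[OF c(1)] by (auto simp: is_chart_def)
  then have "smooth_on (\<psi> ` V) ((\<lambda>q. c) \<circ> inv_into V \<psi>)"
    unfolding smooth_on_def comp_def by (simp add: Ck_on_const)
  then show ?thesis using smooth_near_chart[OF c] \<open>open V\<close> c(2) by blast
qed

lemma smooth_near_diff:
  assumes "smooth_near A p f" "smooth_near A p g"
  shows "smooth_near A p (\<lambda>q. f q - g q)"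
proof -
  have "smooth_near A p (\<lambda>q. f q + (- 1) * g q)"
    by (intro smooth_near_add smooth_near_mult smooth_near_const assms)
  then show ?thesis by simp
qed

lemma smooth_near_sum:
  assumes "\<And>i. i \<in> I \<Longrightarrow> smooth_near A p (f i)"
  shows "smooth_near A p (\<lambda>q. \<Sum>i\<in>I. f i q)"
  using assms
proof (induction I rule: infinite_finite_induct)
  case (insert i I)
  then have "smooth_near A p (\<lambda>q. f i q + (\<Sum>i\<in>I. f i q))"
    by (intro smooth_near_add) simp_all
  then show ?case using insert by simp
qed (simp_all add: smooth_near_const)

lemma smooth_near_cong:
  assumes "smooth_near A p f" "eventually (\<lambda>q. f q = g q) (nhds p)"
  shows "smooth_near A p g"
proof -
  obtain V \<psi> where c: "(V, \<psi>) \<in> A" "p \<in> V" using chart_at .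
  obtain W1 where W1: "open W1" "p \<in> W1" "W1 \<subseteq> V" "smooth_on (\<psi> ` W1) (f \<circ> inv_into V \<psi>)"
    using assms(1) smooth_near_chart[OF c] by blast
  obtain W2 where W2: "open W2" "p \<in> W2" "\<forall>q\<in>W2. f q = g q"
    using assms(2) unfolding eventually_nhds by blast
  let ?W = "W1 \<inter> W2"
  have op: "open (\<psi> ` ?W)" using chart_image_open[OF chart[OF c(1)]] W1 W2 by blast
  have "Ck_on k (g \<circ> inv_into V \<psi>) (\<psi> ` ?W)" for k
  proof (rule Ck_on_cong[OF op])
    show "Ck_on k (f \<circ> inv_into V \<psi>) (\<psi> ` ?W)"
      using W1(4) unfolding smooth_on_def by (blast intro: Ck_on_subset)
    show "(f \<circ> inv_into V \<psi>) y = (g \<circ> inv_into V \<psi>) y" if "y \<in> \<psi> ` ?W" for y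
      using that W1(3) W2(3) chart_inverse[OF chart[OF c(1)]] by auto
  qed
  then show ?thesis
    using W1 W2 by (intro iffD2[OF smooth_near_chart[OF c]] exI[of _ ?W]) (auto simp: smooth_on_def)
qed

text \<open>A function smooth near the point is continuous there, so its nonzero value persists on a
  neighbourhood.\<close>

lemma smooth_near_inverse:
  assumes "smooth_near A p f" "f p \<noteq> 0"
  shows "smooth_near A p (\<lambda>q. inverse (f q))"
    and "eventually (\<lambda>q. f q \<noteq> 0) (nhds p)"
proof -
  obtain V \<psi> where c: "(V, \<psi>) \<in> A" "p \<in> V" using chart_at .
  note ch = chart[OF c(1)]
  obtain W1 where W1: "open W1" "p \<in> W1" "W1 \<subseteq> V" "smooth_on (\<psi> ` W1) (f \<circ> inv_into V \<psi>)"
    using assms(1) smooth_near_chart[OF c] by blast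
  have "continuous_on (\<psi> ` W1) (f \<circ> inv_into V \<psi>)"
    using W1(4) unfolding smooth_on_def by (metis Ck_on.simps(1))
  moreover have "continuous_on W1 \<psi>"
    using ch W1(3) unfolding is_chart_def homeomorphism_def by (auto intro: continuous_on_subset)
  ultimately have "continuous_on W1 (\<lambda>q. (f \<circ> inv_into V \<psi>) (\<psi> q))"
    by (rule continuous_on_compose2) auto
  then have cont: "continuous_on W1 f"
    by (rule continuous_on_eq) (use W1(3) chart_inverse[OF ch] in auto)
  define W where "W = W1 \<inter> f -` (- {0})"
  have "open W"
    unfolding W_def by (rule continuous_open_preimage[OF cont W1(1)]) auto
  moreover have p: "p \<in> W" using W1 assms(2) by (simp add: W_def)
  ultimately show "eventually (\<lambda>q. f q \<noteq> 0) (nhds p)"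
    unfolding eventually_nhds by (intro exI[of _ W]) (auto simp: W_def)
  have sub: "W \<subseteq> V" "W \<subseteq> W1" using W1 W_def by auto
  have "open (\<psi> ` W)" using chart_image_open[OF ch \<open>open W\<close>] sub by blast
  moreover have "Ck_on k (f \<circ> inv_into V \<psi>) (\<psi> ` W)" for k
    using W1(4) sub(2) unfolding smooth_on_def by (blast intro: Ck_on_subset)
  moreover have "(f \<circ> inv_into V \<psi>) x \<noteq> 0" if "x \<in> \<psi> ` W" for x
    using that sub(1) chart_inverse[OF ch] by (auto simp: W_def)
  ultimately have "Ck_on k (\<lambda>x. inverse ((f \<circ> inv_into V \<psi>) x)) (\<psi> ` W)" for k
    by (intro Ck_on_inverse) blast+
  then have "smooth_on (\<psi> ` W) ((\<lambda>q. inverse (f q)) \<circ> inv_into V \<psi>)"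
    by (simp add: smooth_on_def comp_def)
  then show "smooth_near A p (\<lambda>q. inverse (f q))"
    using smooth_near_chart[OF c] \<open>open W\<close> p sub by blast
qed

end

text \<open>The definition of a smooth map provides some pair of charts in which the map is smooth,
  while smoothness of the function on the target can be read in the target chart of that pair. The
  map is continuous near the point, since it is so in coordinates; this makes the domain of the
  composition open.\<close>

lemma smooth_fun_pullback:
  fixes A :: "('m::{second_countable_topology,t2_space}, 'a::euclidean_space) chart set"
    and B :: "('n::{second_countable_topology,t2_space}, 'b::euclidean_space) chart set"
  assumes "smooth_atlas A" "smooth_atlas B" "smooth_map_on A B UNIV F" "smooth_fun B g"
  shows "smooth_fun A (g \<circ> F)"
proof -
  interpret A: smooth_manifold A by standard fact
  interpret B: smooth_manifold B by standard fact
  have "smooth_near A p (g \<circ> F)" for p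
  proof -
    have "\<exists>(U, \<phi>)\<in>A. \<exists>(V, \<psi>)\<in>B. \<exists>W. open W \<and> p \<in> W \<and> W \<subseteq> UNIV \<inter> U \<and> F ` W \<subseteq> V \<and>
        smooth_on (\<phi> ` W) (\<psi> \<circ> F \<circ> inv_into U \<phi>)"
      using assms(3) unfolding smooth_map_on_def by (rule bspec) simp
    then obtain U \<phi> V \<psi> W where c: "(U, \<phi>) \<in> A" "(V, \<psi>) \<in> B" "open W" "p \<in> W" "W \<subseteq> U" "F ` W \<subseteq> V"
        and F: "smooth_on (\<phi> ` W) (\<psi> \<circ> F \<circ> inv_into U \<phi>)"
      by auto
    have p: "p \<in> U" "F p \<in> V" using c by auto
    note cU = A.chart[OF c(1)] and cV = B.chart[OF c(2)]
    have invU: "inv_into U \<phi> (\<phi> q) = q" if "q \<in> W" for q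
      using chart_inverse[OF cU] c(5) that by blast
    have invV: "inv_into V \<psi> (\<psi> (F q)) = F q" if "q \<in> W" for q
      using chart_inverse[OF cV] c(6) that by blast
    have "smooth_near B (F p) g"
      using assms(4) smooth_fun_on_iff_near[OF open_UNIV, of B g] by simp
    then obtain W' where W': "open W'" "F p \<in> W'" "W' \<subseteq> V" "smooth_on (\<psi> ` W') (g \<circ> inv_into V \<psi>)"
      using B.smooth_near_chart[OF c(2) p(2)] by blast
    have "continuous_on W (\<lambda>q. inv_into V \<psi> ((\<psi> \<circ> F \<circ> inv_into U \<phi>) (\<phi> q)))"
    proof (rule continuous_on_compose2[where g = "inv_into V \<psi>"
          and f = "\<lambda>q. (\<psi> \<circ> F \<circ> inv_into U \<phi>) (\<phi> q)"])
      show "continuous_on (\<psi> ` V) (inv_into V \<psi>)"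
        using cV unfolding is_chart_def homeomorphism_def by auto
      show "continuous_on W (\<lambda>q. (\<psi> \<circ> F \<circ> inv_into U \<phi>) (\<phi> q))"
      proof (rule continuous_on_compose2[where g = "\<psi> \<circ> F \<circ> inv_into U \<phi>" and f = \<phi>])
        show "continuous_on (\<phi> ` W) (\<psi> \<circ> F \<circ> inv_into U \<phi>)"
          using F Ck_on.simps(1) unfolding smooth_on_def by blast
        show "continuous_on W \<phi>"
          using cU c(5) unfolding is_chart_def homeomorphism_def by (auto intro: continuous_on_subset)
      qed simp
      show "(\<lambda>q. (\<psi> \<circ> F \<circ> inv_into U \<phi>) (\<phi> q)) ` W \<subseteq> \<psi> ` V"
        using c(6) by (auto simp: invU)
    qed
    then have cont: "continuous_on W F"
      by (rule continuous_on_eq) (simp add: invU invV)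
    let ?W = "W \<inter> F -` W'"
    have W: "open ?W" by (rule continuous_open_preimage[OF cont c(3) W'(1)])
    have im: "open (\<phi> ` ?W)" "open (\<psi> ` W')"
      using chart_image_open[OF cU W] chart_image_open[OF cV W'(1)] c(5) W'(3) by auto
    have "Ck_on k (g \<circ> F \<circ> inv_into U \<phi>) (\<phi> ` ?W)" for k
    proof (rule Ck_on_cong[OF im(1)])
      show "Ck_on k (\<lambda>x. (g \<circ> inv_into V \<psi>) ((\<psi> \<circ> F \<circ> inv_into U \<phi>) x)) (\<phi> ` ?W)"
      proof (rule Ck_on_compose[OF im])
        show "(\<psi> \<circ> F \<circ> inv_into U \<phi>) ` \<phi> ` ?W \<subseteq> \<psi> ` W'"
          by (auto simp: invU)
        show "Ck_on k (\<psi> \<circ> F \<circ> inv_into U \<phi>) (\<phi> ` ?W)"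
          using smooth_on_subset[OF F, of "\<phi> ` ?W"] by (auto simp: smooth_on_def)
        show "Ck_on k (g \<circ> inv_into V \<psi>) (\<psi> ` W')" using W'(4) by (simp add: smooth_on_def)
      qed
      show "(g \<circ> inv_into V \<psi>) ((\<psi> \<circ> F \<circ> inv_into U \<phi>) y) = (g \<circ> F \<circ> inv_into U \<phi>) y"
        if "y \<in> \<phi> ` ?W" for y
        using that by (auto simp: invU invV)
    qed
    then show ?thesis
      using W c W'(2) p
      by (intro iffD2[OF A.smooth_near_chart[OF c(1) p(1)]] exI[of _ ?W]) (auto simp: smooth_on_def)
  qed
  then show ?thesis by (simp add: smooth_fun_on_iff_near)
qed

section \<open>Linear algebra with smooth coefficients\<close>

lemma linear_on_set_add: "linear_on_set T L \<Longrightarrow> u \<in> T \<Longrightarrow> v \<in> T \<Longrightarrow> L (u + v) = L u + L v"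
  and linear_on_set_scaleR: "linear_on_set T L \<Longrightarrow> v \<in> T \<Longrightarrow> L (c *\<^sub>R v) = c *\<^sub>R L v"
  by (auto simp: linear_on_set_def)

lemma linear_on_set_zero: "linear_on_set T L \<Longrightarrow> subspace T \<Longrightarrow> L 0 = 0"
  using linear_on_set_scaleR[of T L 0 0] subspace_0 by fastforce

lemma linear_on_set_minus: "linear_on_set T L \<Longrightarrow> v \<in> T \<Longrightarrow> L (- v) = - L v"
  using linear_on_set_scaleR[of T L v "-1"] by simp

lemma linear_on_set_diff:
  assumes "linear_on_set T L" "subspace T" "u \<in> T" "v \<in> T"
  shows "L (u - v) = L u - L v"
  using linear_on_set_add[OF assms(1,3), of "- v"] linear_on_set_minus[OF assms(1,4)]
    subspace_neg[OF assms(2,4)] by simp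

lemma linear_on_set_sum:
  assumes "linear_on_set T L" "subspace T" "\<And>i. i \<in> I \<Longrightarrow> u i \<in> T"
  shows "L (\<Sum>i\<in>I. c i *\<^sub>R u i) = (\<Sum>i\<in>I. c i *\<^sub>R L (u i))"
  using assms(3)
proof (induction I rule: infinite_finite_induct)
  case (insert i I)
  then have "L (c i *\<^sub>R u i + (\<Sum>i\<in>I. c i *\<^sub>R u i)) = L (c i *\<^sub>R u i) + L (\<Sum>i\<in>I. c i *\<^sub>R u i)"
    by (intro linear_on_set_add[OF assms(1)] subspace_sum[OF assms(2)] subspace_scale[OF assms(2)]) auto
  then show ?case
    using insert linear_on_set_scaleR[OF assms(1), of "u i"] by simp
qed (simp_all add: linear_on_set_zero[OF assms(1,2)])

text \<open>Linearly independent functionals on a space of any dimension have a dual family. The inductive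
  step takes a vector on which the last functional differs from the combination of the earlier ones
  suggested by the dual family so far, removes its components along that family, and normalises.\<close>

lemma dual_vectors:
  fixes l :: "nat \<Rightarrow> 'v::real_vector \<Rightarrow> real"
  assumes G: "subspace G" and lin: "\<And>i. i < k \<Longrightarrow> linear_on_set G (l i)"
    and indep: "\<And>a. \<forall>g\<in>G. (\<Sum>i<k. a i * l i g) = 0 \<Longrightarrow> \<forall>i<k. a i = 0"
  shows "\<exists>g. (\<forall>j<k. g j \<in> G) \<and> (\<forall>i<k. \<forall>j<k. l i (g j) = (if i = j then 1 else 0))"
  using lin indep
proof (induction k)
  case (Suc k)
  have "\<exists>g. (\<forall>j<k. g j \<in> G) \<and> (\<forall>i<k. \<forall>j<k. l i (g j) = (if i = j then 1 else 0))"
  proof (rule Suc.IH)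
    fix a :: "nat \<Rightarrow> real" assume "\<forall>g\<in>G. (\<Sum>i<k. a i * l i g) = 0"
    then have "\<forall>i<Suc k. (a(k := 0)) i = 0" by (intro Suc.prems(2)) simp
    then show "\<forall>i<k. a i = 0" by (auto simp: less_Suc_eq split: if_splits)
  qed (simp add: Suc.prems)
  then obtain g where g: "\<And>j. j < k \<Longrightarrow> g j \<in> G"
      "\<And>i j. i < k \<Longrightarrow> j < k \<Longrightarrow> l i (g j) = (if i = j then 1 else 0)" by blast
  have "\<exists>u\<in>G. l k u \<noteq> (\<Sum>j<k. l k (g j) * l j u)"
  proof (rule ccontr)
    assume "\<not> ?thesis"
    then have "\<forall>u\<in>G. (\<Sum>i<Suc k. ((\<lambda>j. - l k (g j))(k := 1)) i * l i u) = 0"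
      by (simp add: sum_negf)
    from Suc.prems(2)[OF this] show False by auto
  qed
  then obtain u where u: "u \<in> G" "l k u \<noteq> (\<Sum>j<k. l k (g j) * l j u)" by blast
  define h where "h = u - (\<Sum>j<k. l j u *\<^sub>R g j)"
  have sumG: "(\<Sum>j<k. l j u *\<^sub>R g j) \<in> G"
    by (intro subspace_sum[OF G] subspace_scale[OF G] g) simp
  have h: "h \<in> G" unfolding h_def by (intro subspace_diff[OF G] u sumG)
  have lh: "l i h = l i u - (\<Sum>j<k. l j u * l i (g j))" if "i < Suc k" for i
    using linear_on_set_diff[OF Suc.prems(1)[OF that] G u(1) sumG]
      linear_on_set_sum[OF Suc.prems(1)[OF that] G, of "{..<k}" g "\<lambda>j. l j u"] g(1)
    by (simp add: h_def)
  have h0: "l i h = 0" if "i < k" for i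
    using that by (simp add: lh g(2) if_distrib[of "(*) _"] cong: if_cong)
  have hk: "l k h \<noteq> 0" using u(2) by (simp add: lh mult.commute)
  define g' where "g' j = (if j = k then inverse (l k h) *\<^sub>R h
      else g j - (l k (g j) * inverse (l k h)) *\<^sub>R h)" for j
  have "g' j \<in> G" if "j < Suc k" for j
    using that g(1) h unfolding g'_def
    by (auto simp: less_Suc_eq intro!: subspace_diff[OF G] subspace_scale[OF G])
  moreover have "l i (g' j) = (if i = j then 1 else 0)" if "i < Suc k" "j < Suc k" for i j
  proof (cases "j = k")
    case True
    then show ?thesis
      using that h0[of i] hk linear_on_set_scaleR[OF Suc.prems(1)[OF that(1)] h]
      by (auto simp: g'_def less_Suc_eq)
  next
    case False
    then have j: "j < k" using that by simp
    have "l i (g' j) = l i (g j) - (l k (g j) * inverse (l k h)) * l i h"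
      using linear_on_set_diff[OF Suc.prems(1)[OF that(1)] G g(1)[OF j] subspace_scale[OF G h]]
        linear_on_set_scaleR[OF Suc.prems(1)[OF that(1)] h] False by (simp add: g'_def)
    then show ?thesis
      using that h0[of i] hk g(2)[OF _ j, of i] False by (auto simp: less_Suc_eq)
  qed
  ultimately show ?case by blast
qed simp

text \<open>Only a pointwise solution is given; its smoothness is the claim. Gaussian elimination with the
  last diagonal entry as pivot removes the last unknown. At the point itself the coefficient matrix
  stays the identity, so every pivot is invertible near it.\<close>

lemma (in smooth_manifold) smooth_near_linear_system:
  fixes k :: nat
  assumes "\<And>i j. i < k \<Longrightarrow> j < k \<Longrightarrow> smooth_near A p (B i j)"
    and "\<And>j. j < k \<Longrightarrow> smooth_near A p (d j)"
    and "\<And>i j. i < k \<Longrightarrow> j < k \<Longrightarrow> B i j p = (if i = j then 1 else 0)"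
    and "eventually (\<lambda>q. \<forall>j<k. (\<Sum>i<k. c i q * B i j q) = d j q) (nhds p)"
  shows "\<forall>i<k. smooth_near A p (c i)"
  using assms
proof (induction k arbitrary: B d)
  case (Suc k)
  let ?b = "\<lambda>q. inverse (B k k q)"
  have b: "smooth_near A p ?b" "eventually (\<lambda>q. B k k q \<noteq> 0) (nhds p)"
    using smooth_near_inverse[OF Suc.prems(1)[of k k]] Suc.prems(3)[of k k] by auto
  have IH: "\<forall>i<k. smooth_near A p (c i)"
  proof (rule Suc.IH[where B = "\<lambda>i j q. B i j q - B i k q * (B k j q * ?b q)"
        and d = "\<lambda>j q. d j q - d k q * (B k j q * ?b q)"])
    show "smooth_near A p (\<lambda>q. B i j q - B i k q * (B k j q * ?b q))" if "i < k" "j < k" for i j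
      using that by (intro smooth_near_diff smooth_near_mult Suc.prems(1) b) auto
    show "smooth_near A p (\<lambda>q. d j q - d k q * (B k j q * ?b q))" if "j < k" for j
      using that by (intro smooth_near_diff smooth_near_mult Suc.prems(1,2) b) auto
    show "B i j p - B i k p * (B k j p * ?b p) = (if i = j then 1 else 0)" if "i < k" "j < k" for i j
      using that Suc.prems(3) by simp
    show "eventually (\<lambda>q. \<forall>j<k. (\<Sum>i<k. c i q * (B i j q - B i k q * (B k j q * ?b q)))
        = d j q - d k q * (B k j q * ?b q)) (nhds p)"
      using Suc.prems(4) b(2)
    proof eventually_elim
      case (elim q)
      show ?case
      proof (intro allI impI)
        fix j assume "j < k"
        then have j: "(\<Sum>i<k. c i q * B i j q) = d j q - c k q * B k j q"
          and k: "(\<Sum>i<k. c i q * B i k q) = d k q - c k q * B k k q"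
          using elim(1) by (auto simp: less_Suc_eq)
        have "(\<Sum>i<k. c i q * (B i j q - B i k q * (B k j q * ?b q)))
            = (\<Sum>i<k. c i q * B i j q) - (\<Sum>i<k. c i q * B i k q) * (B k j q * ?b q)"
          by (simp add: right_diff_distrib sum_subtractf sum_distrib_right mult.assoc)
        also have "\<dots> = d j q - d k q * (B k j q * ?b q)"
          using elim(2) unfolding j k by (simp add: field_simps)
        finally show "(\<Sum>i<k. c i q * (B i j q - B i k q * (B k j q * ?b q)))
            = d j q - d k q * (B k j q * ?b q)" .
      qed
    qed
  qed
  have "smooth_near A p (\<lambda>q. (d k q - (\<Sum>i<k. c i q * B i k q)) * ?b q)"
    using IH Suc.prems(1,2)
    by (intro smooth_near_mult[OF _ b(1)] smooth_near_diff smooth_near_sum smooth_near_mult) auto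
  moreover have "eventually (\<lambda>q. (d k q - (\<Sum>i<k. c i q * B i k q)) * ?b q = c k q) (nhds p)"
    using Suc.prems(4) b(2) by eventually_elim (auto simp: less_Suc_eq field_simps)
  ultimately have "smooth_near A p (c k)" by (rule smooth_near_cong)
  with IH show ?case by (auto simp: less_Suc_eq)
qed simp

lemma span_family_coeffs:
  assumes "inj_on X {..<k::nat}" "v \<in> span (X ` {..<k})"
  shows "\<exists>c. v = (\<Sum>i<k. c i *\<^sub>R X i)"
proof -
  obtain u where "v = (\<Sum>w\<in>X ` {..<k}. u w *\<^sub>R w)"
    using assms(2) span_finite[of "X ` {..<k}"] by auto
  then have "v = (\<Sum>i<k. u (X i) *\<^sub>R X i)" by (simp add: sum.reindex[OF assms(1)])
  then show ?thesis by (rule exI[where x = "\<lambda>i. u (X i)"])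
qed

lemma independent_family_coeffs:
  assumes "inj_on X {..<k::nat}" "independent (X ` {..<k})" "(\<Sum>i<k. c i *\<^sub>R X i) = 0" "i < k"
  shows "c i = 0"
proof -
  let ?u = "\<lambda>w. c (inv_into {..<k} X w)"
  have "(\<Sum>w\<in>X ` {..<k}. ?u w *\<^sub>R w) = (\<Sum>i<k. c i *\<^sub>R X i)"
    unfolding sum.reindex[OF assms(1)] by (rule sum.cong) (simp_all add: assms(1))
  then have "?u (X i) = 0"
    using assms(3,4) by (intro independentD[OF assms(2)]) auto
  then show ?thesis using assms(1,4) by simp
qed

lemma proj_along_unique:
  assumes "subspace S" "subspace T" "S \<inter> T = {0}" "a \<in> S" "v - a \<in> T"
  shows "proj_along S T v = a"
  unfolding proj_along_def
proof (rule the_equality)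
  fix b assume b: "b \<in> S \<and> v - b \<in> T"
  have "b - a \<in> S" using b assms(4) subspace_diff[OF assms(1)] by blast
  moreover have "b - a \<in> T" using subspace_diff[OF assms(2,5), of "v - b"] b by simp
  ultimately have "b - a \<in> S \<inter> T" by blast
  then show "b = a" unfolding assms(3) by simp
qed (use assms(4,5) in blast)

text \<open>The assumptions give \<open>L u = a u\<close>, hence \<open>0 = L (L u) = a L u\<close>; either factor being zero makes
  \<open>L u\<close> vanish.\<close>

lemma linear_on_set_cube_eq_zero:
  assumes lin: "linear_on_set T L" and T: "subspace T" and u: "u \<in> T"
    and sq: "L (L u) = 0" and cube: "L (L (L u)) = L u - a *\<^sub>R u"
  shows "L u = 0"
proof -
  have eigen: "L u = a *\<^sub>R u"
    using cube sq linear_on_set_zero[OF lin T] by simp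
  then have "a *\<^sub>R L u = 0"
    using sq linear_on_set_scaleR[OF lin u, of a] by simp
  then show ?thesis using eigen by auto
qed

section \<open>Tangent vectors and Lie brackets\<close>

lemma smooth_fun_iff_near: "smooth_fun A f \<longleftrightarrow> (\<forall>p. smooth_near A p f)"
  by (simp add: smooth_fun_on_iff_near)

context smooth_manifold
begin

lemma smooth_fun_add: "smooth_fun A f \<Longrightarrow> smooth_fun A g \<Longrightarrow> smooth_fun A (\<lambda>q. f q + g q)"
  and smooth_fun_diff: "smooth_fun A f \<Longrightarrow> smooth_fun A g \<Longrightarrow> smooth_fun A (\<lambda>q. f q - g q)"
  and smooth_fun_mult: "smooth_fun A f \<Longrightarrow> smooth_fun A g \<Longrightarrow> smooth_fun A (\<lambda>q. f q * g q)"
  and smooth_fun_const: "smooth_fun A (\<lambda>q. c)"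
  by (simp_all add: smooth_fun_iff_near smooth_near_add smooth_near_diff smooth_near_mult
      smooth_near_const)

lemma subspace_smooth_fun: "subspace {f. smooth_fun A f}"
  using smooth_fun_const[of 0] smooth_fun_add smooth_fun_mult[OF smooth_fun_const]
  by (auto simp: subspace_def plus_fun_def zero_fun_def scaleR_fun_def)

lemma subspace_tangent_space: "subspace (tangent_space A p)"
  by (auto simp: subspace_def tangent_space_def algebra_simps)

lemma tangent_add:
  "v \<in> tangent_space A p \<Longrightarrow> smooth_fun A f \<Longrightarrow> smooth_fun A g \<Longrightarrow> v (\<lambda>q. f q + g q) = v f + v g"
  unfolding tangent_space_def plus_fun_def by blast

lemma tangent_scale:
  "v \<in> tangent_space A p \<Longrightarrow> smooth_fun A f \<Longrightarrow> v (\<lambda>q. c * f q) = c * v f"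
  unfolding tangent_space_def scaleR_fun_def by simp

lemma tangent_mult:
  "v \<in> tangent_space A p \<Longrightarrow> smooth_fun A f \<Longrightarrow> smooth_fun A g \<Longrightarrow>
   v (\<lambda>q. f q * g q) = f p * v g + g p * v f"
  unfolding tangent_space_def times_fun_def by blast

lemma tangent_not_smooth: "v \<in> tangent_space A p \<Longrightarrow> \<not> smooth_fun A f \<Longrightarrow> v f = 0"
  by (simp add: tangent_space_def)

lemma tangent_diff:
  assumes v: "v \<in> tangent_space A p" and f: "smooth_fun A f" and g: "smooth_fun A g"
  shows "v (\<lambda>q. f q - g q) = v f - v g"
  using tangent_add[OF v f smooth_fun_mult[OF smooth_fun_const[of "-1"] g]] tangent_scale[OF v g, of "-1"]
  by simp

lemma tangent_const: "v \<in> tangent_space A p \<Longrightarrow> v (\<lambda>q. c) = 0"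
  using tangent_mult[of v p "\<lambda>q. 1" "\<lambda>q. 1"] tangent_scale[of v p "\<lambda>q. 1" c]
  by (simp add: smooth_fun_const)

lemma tangent_spaceI:
  assumes "\<And>f g. smooth_fun A f \<Longrightarrow> smooth_fun A g \<Longrightarrow> v (\<lambda>q. f q + g q) = v f + v g"
    and "\<And>c f. smooth_fun A f \<Longrightarrow> v (\<lambda>q. c * f q) = c * v f"
    and "\<And>f g. smooth_fun A f \<Longrightarrow> smooth_fun A g \<Longrightarrow> v (\<lambda>q. f q * g q) = f p * v g + g p * v f"
    and "\<And>f. \<not> smooth_fun A f \<Longrightarrow> v f = 0"
  shows "v \<in> tangent_space A p"
  using assms by (simp add: tangent_space_def plus_fun_def times_fun_def scaleR_fun_def)

lemma vf_tangent: "vector_field A X \<Longrightarrow> X p \<in> tangent_space A p"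
  and vf_smooth: "vector_field A X \<Longrightarrow> smooth_fun A f \<Longrightarrow> smooth_fun A (\<lambda>q. X q f)"
  by (simp_all add: vector_field_on_def)

lemma vf_not_smooth: "vector_field A X \<Longrightarrow> \<not> smooth_fun A f \<Longrightarrow> X p f = 0"
  using tangent_not_smooth vf_tangent by blast

lemma vector_field_scale:
  assumes "smooth_fun A f" "vector_field A X"
  shows "vector_field A (\<lambda>q. f q *\<^sub>R X q)"
  using assms subspace_scale[OF subspace_tangent_space]
  by (simp add: vector_field_on_def smooth_fun_mult)

lemma vector_field_diff:
  assumes "vector_field A X" "vector_field A Y"
  shows "vector_field A (\<lambda>q. X q - Y q)"
  using assms subspace_diff[OF subspace_tangent_space]
  by (simp add: vector_field_on_def smooth_fun_diff)

text \<open>In the Leibniz rule the mixed terms \<open>X f \<cdot> Y g + X g \<cdot> Y f\<close> are symmetric in the two fields and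
  cancel.\<close>

lemma lie_bracket_tangent:
  assumes X: "vector_field A X" and Y: "vector_field A Y"
  shows "lie_bracket X Y p \<in> tangent_space A p"
proof (rule tangent_spaceI)
  note Xt = vf_tangent[OF X] and Yt = vf_tangent[OF Y]
  note Xs = vf_smooth[OF X] and Ys = vf_smooth[OF Y]
  fix f g c
  show "lie_bracket X Y p (\<lambda>q. f q + g q) = lie_bracket X Y p f + lie_bracket X Y p g"
    if f: "smooth_fun A f" and g: "smooth_fun A g"
    by (simp add: lie_bracket_def tangent_add[OF Xt f g] tangent_add[OF Yt f g]
        tangent_add[OF Xt Ys[OF f] Ys[OF g]] tangent_add[OF Yt Xs[OF f] Xs[OF g]])
  show "lie_bracket X Y p (\<lambda>q. c * f q) = c * lie_bracket X Y p f" if f: "smooth_fun A f"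
    by (simp add: lie_bracket_def tangent_scale[OF Xt f] tangent_scale[OF Yt f]
        tangent_scale[OF Xt Ys[OF f]] tangent_scale[OF Yt Xs[OF f]] right_diff_distrib)
  show "lie_bracket X Y p (\<lambda>q. f q * g q) = f p * lie_bracket X Y p g + g p * lie_bracket X Y p f"
    if f: "smooth_fun A f" and g: "smooth_fun A g"
  proof -
    have leib: "Z p (\<lambda>q. f q * W q g + g q * W q f)
        = f p * Z p (\<lambda>q. W q g) + W p g * Z p f + (g p * Z p (\<lambda>q. W q f) + W p f * Z p g)"
      if Z: "vector_field A Z" and W: "vector_field A W" for Z W
      by (simp add: tangent_add[OF vf_tangent[OF Z] smooth_fun_mult[OF f vf_smooth[OF W g]]
            smooth_fun_mult[OF g vf_smooth[OF W f]]]
          tangent_mult[OF vf_tangent[OF Z] f vf_smooth[OF W g]]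
          tangent_mult[OF vf_tangent[OF Z] g vf_smooth[OF W f]])
    show ?thesis
      by (simp add: lie_bracket_def tangent_mult[OF Xt f g] tangent_mult[OF Yt f g]
          leib[OF X Y] leib[OF Y X] algebra_simps)
  qed
  show "lie_bracket X Y p f = 0" if "\<not> smooth_fun A f"
    using that by (simp add: lie_bracket_def vf_not_smooth[OF X] vf_not_smooth[OF Y]
        tangent_const[OF Xt] tangent_const[OF Yt])
qed

lemma lie_bracket_commute: "lie_bracket X Y p = - lie_bracket Y X p"
  by (simp add: lie_bracket_def fun_eq_iff)

lemma lie_bracket_zero_right:
  assumes "vector_field A X"
  shows "lie_bracket X (\<lambda>q. 0) p = 0"
  by (simp add: lie_bracket_def fun_eq_iff tangent_const[OF vf_tangent[OF assms]])

text \<open>Both rules for the first argument of the bracket come from additivity and the Leibniz rule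
  for the second field, which hold on smooth functions. The proofs therefore separate the smooth
  test functions from the others, on which every tangent vector is zero by convention.\<close>

lemma lie_bracket_diff_left:
  assumes X: "vector_field A X" and Y: "vector_field A Y" and Z: "vector_field A Z"
  shows "lie_bracket (\<lambda>q. X q - Y q) Z p = lie_bracket X Z p - lie_bracket Y Z p"
proof
  fix f
  show "lie_bracket (\<lambda>q. X q - Y q) Z p f = (lie_bracket X Z p - lie_bracket Y Z p) f"
  proof (cases "smooth_fun A f")
    case True
    then show ?thesis
      by (simp add: lie_bracket_def
          tangent_diff[OF vf_tangent[OF Z] vf_smooth[OF X True] vf_smooth[OF Y True]])
  next
    case False
    then show ?thesis
      by (simp add: lie_bracket_def vf_not_smooth[OF X] vf_not_smooth[OF Y] vf_not_smooth[OF Z]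
          tangent_const[OF vf_tangent[OF Z]])
  qed
qed

lemma lie_bracket_scale_left:
  assumes h: "smooth_fun A h" and X: "vector_field A X" and Z: "vector_field A Z"
  shows "lie_bracket (\<lambda>q. h q *\<^sub>R X q) Z p = h p *\<^sub>R lie_bracket X Z p - Z p h *\<^sub>R X p"
proof
  fix f
  show "lie_bracket (\<lambda>q. h q *\<^sub>R X q) Z p f = (h p *\<^sub>R lie_bracket X Z p - Z p h *\<^sub>R X p) f"
  proof (cases "smooth_fun A f")
    case True
    then show ?thesis
      by (simp add: lie_bracket_def tangent_mult[OF vf_tangent[OF Z] h vf_smooth[OF X True]]
          algebra_simps)
  next
    case False
    then show ?thesis
      by (simp add: lie_bracket_def vf_not_smooth[OF X] vf_not_smooth[OF Z]
          tangent_const[OF vf_tangent[OF Z]] tangent_const[OF vf_tangent[OF X]])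
  qed
qed

end

section \<open>Smoothness of the horizontal projection\<close>

lemma sum_fun_apply: "(\<Sum>i\<in>I. (f i :: 'x \<Rightarrow> real)) x = (\<Sum>i\<in>I. f i x)"
  by (induction I rule: infinite_finite_induct) auto

locale connection_over_base =
  fixes atE :: "('e::{second_countable_topology,t2_space}, 'a::euclidean_space) chart set"
    and atM :: "('m::{second_countable_topology,t2_space}, 'b::euclidean_space) chart set"
    and \<pi> :: "'e \<Rightarrow> 'm" and H V :: "'e \<Rightarrow> 'e tvec set"
  assumes atlasE: "smooth_atlas atE" and atlasM: "smooth_atlas atM"
    and smooth_proj: "smooth_map_on atE atM UNIV \<pi>"
    and vertical: "V = vertical_bundle atE atM \<pi>"
    and connection: "nonlinear_connection atE atM \<pi> H"
begin

sublocale E: smooth_manifold atE by standard (rule atlasE)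
sublocale M: smooth_manifold atM by standard (rule atlasM)

lemma V_iff:
  "v \<in> V p \<longleftrightarrow> v \<in> tangent_space atE p \<and> (\<forall>g. smooth_fun atM g \<longrightarrow> v (g \<circ> \<pi>) = 0)"
  by (auto simp: vertical vertical_bundle_def differential_def fun_eq_iff)

lemma subspace_V: "subspace (V p)"
  using E.subspace_tangent_space[of p] by (auto simp: subspace_def V_iff)

lemma subspace_H: "subspace (H p)"
  using connection unfolding nonlinear_connection_def smooth_distribution_def by (metis subspace_span)

lemma direct_sum:
  "H p \<inter> V p = {0}" "tangent_space atE p = {h + v | h v. h \<in> H p \<and> v \<in> V p}"
  using connection by (simp_all add: nonlinear_connection_def vertical)

lemma V_subset: "V p \<subseteq> tangent_space atE p"
  by (auto simp: V_iff)

lemma H_subset: "H p \<subseteq> tangent_space atE p"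
proof
  fix h assume "h \<in> H p"
  moreover have "h = h + 0" "0 \<in> V p" using subspace_0[OF subspace_V] by auto
  ultimately show "h \<in> tangent_space atE p" unfolding direct_sum(2) by blast
qed

lemma proj_decompose:
  assumes "h \<in> H p" "v \<in> V p"
  shows "proj_along (H p) (V p) (h + v) = h" "proj_along (V p) (H p) (h + v) = v"
  using proj_along_unique[OF subspace_H subspace_V direct_sum(1) assms(1), of "h + v"]
    proj_along_unique[OF subspace_V subspace_H _ assms(2), of p "h + v"] assms direct_sum(1)
  by (auto simp: Int_commute)

lemma decompose:
  assumes "v \<in> tangent_space atE p"
  obtains h w where "h \<in> H p" "w \<in> V p" "v = h + w"
    "proj_along (H p) (V p) v = h" "proj_along (V p) (H p) v = w"
  using assms unfolding direct_sum(2) using proj_decompose by blast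

lemma linear_proj:
  "linear_on_set (tangent_space atE p) (proj_along (H p) (V p))"
  "linear_on_set (tangent_space atE p) (proj_along (V p) (H p))"
proof -
  have add: "proj_along (H p) (V p) (u + v) = proj_along (H p) (V p) u + proj_along (H p) (V p) v
      \<and> proj_along (V p) (H p) (u + v) = proj_along (V p) (H p) u + proj_along (V p) (H p) v"
    if u: "u \<in> tangent_space atE p" and v: "v \<in> tangent_space atE p" for u v
  proof -
    obtain h w where 1: "h \<in> H p" "w \<in> V p" "u = h + w"
      "proj_along (H p) (V p) u = h" "proj_along (V p) (H p) u = w" using decompose[OF u] .
    obtain h' w' where 2: "h' \<in> H p" "w' \<in> V p" "v = h' + w'"
      "proj_along (H p) (V p) v = h'" "proj_along (V p) (H p) v = w'" using decompose[OF v] .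
    have "u + v = (h + h') + (w + w')" using 1 2 by simp
    then show ?thesis
      using proj_decompose[OF subspace_add[OF subspace_H 1(1) 2(1)] subspace_add[OF subspace_V 1(2) 2(2)]]
        1 2 by metis
  qed
  have scale: "proj_along (H p) (V p) (c *\<^sub>R v) = c *\<^sub>R proj_along (H p) (V p) v
      \<and> proj_along (V p) (H p) (c *\<^sub>R v) = c *\<^sub>R proj_along (V p) (H p) v"
    if v: "v \<in> tangent_space atE p" for c v
  proof -
    obtain h w where 1: "h \<in> H p" "w \<in> V p" "v = h + w"
      "proj_along (H p) (V p) v = h" "proj_along (V p) (H p) v = w" using decompose[OF v] .
    have "c *\<^sub>R v = c *\<^sub>R h + c *\<^sub>R w" using 1 by (simp add: scaleR_add_right)
    then show ?thesis
      using proj_decompose[OF subspace_scale[OF subspace_H 1(1)] subspace_scale[OF subspace_V 1(2)]]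
        1 by metis
  qed
  show "linear_on_set (tangent_space atE p) (proj_along (H p) (V p))"
    "linear_on_set (tangent_space atE p) (proj_along (V p) (H p))"
    unfolding linear_on_set_def using add scale by blast+
qed

lemma vf_part_mem:
  assumes "vector_field atE X"
  shows "vf_part H V X p \<in> H p" "X p - vf_part H V X p \<in> V p" "vf_part V H X p \<in> V p"
    "vf_part V H X p = X p - vf_part H V X p"
proof -
  obtain h w where "h \<in> H p" "w \<in> V p" "X p = h + w"
    "proj_along (H p) (V p) (X p) = h" "proj_along (V p) (H p) (X p) = w"
    using decompose[OF E.vf_tangent[OF assms]] .
  then show "vf_part H V X p \<in> H p" "X p - vf_part H V X p \<in> V p" "vf_part V H X p \<in> V p"
    "vf_part V H X p = X p - vf_part H V X p"
    by (simp_all add: vf_part_def)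
qed

text \<open>The coefficients of the horizontal part in a local frame solve a linear system with smooth
  data, obtained by testing against functions pulled back from the base, on which the vertical part
  vanishes.\<close>

lemma smooth_near_horizontal_part:
  assumes X: "vector_field atE X" and f: "smooth_fun atE f"
  shows "smooth_near atE p (\<lambda>q. vf_part H V X q f)"
proof -
  have "smooth_distribution atE H" using connection by (simp add: nonlinear_connection_def)
  then obtain k :: nat and U Y where U: "open U" "p \<in> U"
    and Y: "\<forall>i<k. vector_field_on atE U (Y i)"
    and frame: "\<forall>q\<in>U. inj_on (\<lambda>i. Y i q) {..<k} \<and>
      independent ((\<lambda>i. Y i q) ` {..<k}) \<and> H q = span ((\<lambda>i. Y i q) ` {..<k})"
    unfolding smooth_distribution_def by blast
  have YH: "Y i q \<in> H q" if "i < k" "q \<in> U" for i q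
    using bspec[OF frame that(2)] that(1) by (auto intro: span_base)
  have Ysmooth: "smooth_near atE p (\<lambda>q. Y i q h)" if "i < k" "smooth_fun atE h" for i h
    using Y[rule_format, OF that(1)] that(2) U smooth_fun_on_iff_near[OF U(1)] by (auto simp: vector_field_on_def)
  have pull: "smooth_fun atE (g \<circ> \<pi>)" if "smooth_fun atM g" for g
    using smooth_fun_pullback[OF atlasE atlasM smooth_proj that] .
  \<comment> \<open>A combination of the frame that kills all pulled back functions is vertical, hence zero: the
    functionals \<open>g \<mapsto> Y i p (g \<circ> \<pi>)\<close> are independent.\<close>
  have "\<exists>g. (\<forall>j<k. g j \<in> {g. smooth_fun atM g}) \<and>
      (\<forall>i<k. \<forall>j<k. Y i p (g j \<circ> \<pi>) = (if i = j then 1 else 0))"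
  proof (rule dual_vectors[where l = "\<lambda>i g. Y i p (g \<circ> \<pi>)"])
    show "subspace {g. smooth_fun atM g}" by (rule M.subspace_smooth_fun)
    show "linear_on_set {g. smooth_fun atM g} (\<lambda>g. Y i p (g \<circ> \<pi>))" if "i < k" for i
    proof -
      have t: "Y i p \<in> tangent_space atE p" using YH[OF that U(2)] H_subset by blast
      show ?thesis
        using E.tangent_add[OF t pull pull] E.tangent_scale[OF t pull]
        by (simp add: linear_on_set_def comp_def)
    qed
    fix a :: "nat \<Rightarrow> real"
    assume a: "\<forall>g\<in>{g. smooth_fun atM g}. (\<Sum>i<k. a i * Y i p (g \<circ> \<pi>)) = 0"
    let ?v = "\<Sum>i<k. a i *\<^sub>R Y i p"
    have "?v \<in> H p"
      using YH U(2) by (intro subspace_sum[OF subspace_H] subspace_scale[OF subspace_H]) auto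
    moreover from this have "?v \<in> V p"
      using a H_subset by (auto simp: V_iff sum_fun_apply)
    ultimately have "?v = 0" using direct_sum(1) by blast
    then show "\<forall>i<k. a i = 0"
      using independent_family_coeffs[of "\<lambda>i. Y i p" k a] bspec[OF frame U(2)] by blast
  qed
  then obtain g where g: "\<And>j. j < k \<Longrightarrow> smooth_fun atM (g j)"
    "\<And>i j. i < k \<Longrightarrow> j < k \<Longrightarrow> Y i p (g j \<circ> \<pi>) = (if i = j then 1 else 0)"
    unfolding mem_Collect_eq by blast
  note part = vf_part_mem[OF X]
  have "\<exists>c. vf_part H V X q = (\<Sum>i<k. c i *\<^sub>R Y i q)" if "q \<in> U" for q
    using span_family_coeffs[of "\<lambda>i. Y i q" k "vf_part H V X q"] part(1)[of q] bspec[OF frame that]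
    by simp
  then obtain c where c: "\<And>q. q \<in> U \<Longrightarrow> vf_part H V X q = (\<Sum>i<k. c q i *\<^sub>R Y i q)" by metis
  have inU: "eventually (\<lambda>q. q \<in> U) (nhds p)" using U by (rule eventually_nhds_in_open)
  have "\<forall>i<k. smooth_near atE p (\<lambda>q. c q i)"
  proof (rule E.smooth_near_linear_system[where B = "\<lambda>i j q. Y i q (g j \<circ> \<pi>)"
        and d = "\<lambda>j q. X q (g j \<circ> \<pi>)"])
    show "smooth_near atE p (\<lambda>q. Y i q (g j \<circ> \<pi>))" if "i < k" "j < k" for i j
      using that by (intro Ysmooth pull g)
    show "smooth_near atE p (\<lambda>q. X q (g j \<circ> \<pi>))" if "j < k" for j
      using E.vf_smooth[OF X pull[OF g(1)[OF that]]] by (simp add: smooth_fun_iff_near)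
    show "Y i p (g j \<circ> \<pi>) = (if i = j then 1 else 0)" if "i < k" "j < k" for i j
      using that by (rule g(2))
    show "eventually (\<lambda>q. \<forall>j<k. (\<Sum>i<k. c q i * Y i q (g j \<circ> \<pi>)) = X q (g j \<circ> \<pi>)) (nhds p)"
      using inU
    proof eventually_elim
      case (elim q)
      show ?case
      proof (intro allI impI)
        fix j assume "j < k"
        then have "(X q - vf_part H V X q) (g j \<circ> \<pi>) = 0"
          using part(2)[of q] g(1) by (simp add: V_iff)
        then show "(\<Sum>i<k. c q i * Y i q (g j \<circ> \<pi>)) = X q (g j \<circ> \<pi>)"
          by (simp add: c[OF elim] sum_fun_apply)
      qed
    qed
  qed
  then have "smooth_near atE p (\<lambda>q. \<Sum>i<k. c q i * Y i q f)"
    using Ysmooth f by (intro E.smooth_near_sum E.smooth_near_mult) auto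
  moreover have "eventually (\<lambda>q. (\<Sum>i<k. c q i * Y i q f) = vf_part H V X q f) (nhds p)"
    using inU by eventually_elim (simp add: c sum_fun_apply)
  ultimately show ?thesis by (rule E.smooth_near_cong)
qed

lemma vector_field_parts:
  assumes X: "vector_field atE X"
  shows "vector_field atE (vf_part H V X)" "vector_field atE (vf_part V H X)"
proof -
  note parts = vf_part_mem(1)[OF X] vf_part_mem(4)[OF X]
  show H: "vector_field atE (vf_part H V X)"
    using parts(1) H_subset smooth_near_horizontal_part[OF X]
    by (auto simp: vector_field_on_def smooth_fun_iff_near)
  have "vf_part V H X = (\<lambda>q. X q - vf_part H V X q)" using parts(2) by blast
  then show "vector_field atE (vf_part V H X)" using E.vector_field_diff[OF X H] by simp
qed

lemma one_form_parts:
  assumes "one_form atE \<omega>"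
  shows "one_form atE (form_part H V \<omega>)" "one_form atE (form_part V H \<omega>)"
proof -
  have "proj_along (H p) (V p) v \<in> tangent_space atE p" "proj_along (V p) (H p) v \<in> tangent_space atE p"
    if "v \<in> tangent_space atE p" for v p
    using decompose[OF that] H_subset V_subset by (metis subsetD)+
  then have "linear_on_set (tangent_space atE p) (form_part H V \<omega> p)"
    "linear_on_set (tangent_space atE p) (form_part V H \<omega> p)" for p
    using assms linear_proj[of p] unfolding one_form_def linear_on_set_def form_part_def by simp_all
  then show "one_form atE (form_part H V \<omega>)" "one_form atE (form_part V H \<omega>)"
    using assms vector_field_parts by (auto simp: one_form_def form_part_def vf_part_def)
qed

end

section \<open>Normal structures with two complementary one-forms\<close>

text \<open>The assumptions are invariant under exchanging the pairs \<open>(\<alpha>, \<xi>)\<close> and \<open>(\<beta>, \<zeta>)\<close>, so a fact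
  proved for one of the two pairs also holds for the other.\<close>

locale normal_paracontact_frame = smooth_manifold A
  for A :: "('m::{second_countable_topology,t2_space}, 'a::euclidean_space) chart set" +
  fixes \<phi> :: "'m \<Rightarrow> 'm tvec \<Rightarrow> 'm tvec" and \<alpha> \<beta> :: "'m \<Rightarrow> 'm tvec \<Rightarrow> real"
    and \<xi> \<zeta> :: "'m \<Rightarrow> 'm tvec"
  assumes endo: "endomorphism_field A \<phi>" and form: "one_form A \<alpha>" "one_form A \<beta>"
    and field: "vector_field A \<xi>" "vector_field A \<zeta>"
    and dual: "\<alpha> p (\<xi> p) = 1" "\<alpha> p (\<zeta> p) = 0" "\<beta> p (\<xi> p) = 0" "\<beta> p (\<zeta> p) = 1"
    and phi_fields: "\<phi> p (\<xi> p) = 0" "\<phi> p (\<zeta> p) = 0"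
    and phi_phi: "v \<in> tangent_space A p \<Longrightarrow> \<phi> p (\<phi> p v) = v - \<alpha> p v *\<^sub>R \<xi> p - \<beta> p v *\<^sub>R \<zeta> p"
    and normal: "vector_field A X \<Longrightarrow> vector_field A Y \<Longrightarrow>
      nijenhuis \<phi> X Y p - ext_deriv \<alpha> X Y p *\<^sub>R \<xi> p - ext_deriv \<beta> X Y p *\<^sub>R \<zeta> p = 0"
begin

lemma swap: "normal_paracontact_frame A \<phi> \<beta> \<alpha> \<zeta> \<xi>"
proof
  show "nijenhuis \<phi> X Y p - ext_deriv \<beta> X Y p *\<^sub>R \<zeta> p - ext_deriv \<alpha> X Y p *\<^sub>R \<xi> p = 0"
    if "vector_field A X" "vector_field A Y" for X Y p
    using normal[OF that, of p] by (simp add: fun_eq_iff algebra_simps)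
  show "\<phi> p (\<phi> p v) = v - \<beta> p v *\<^sub>R \<zeta> p - \<alpha> p v *\<^sub>R \<xi> p" if "v \<in> tangent_space A p" for v p
    using phi_phi[OF that] by (simp add: fun_eq_iff algebra_simps)
qed (use endo form field dual phi_fields in auto)

lemma phi_linear: "linear_on_set (tangent_space A p) (\<phi> p)"
  and alpha_linear: "linear_on_set (tangent_space A p) (\<alpha> p)"
  and beta_linear: "linear_on_set (tangent_space A p) (\<beta> p)"
  using endo form by (auto simp: endomorphism_field_def one_form_def)

lemma phi_tangent: "v \<in> tangent_space A p \<Longrightarrow> \<phi> p v \<in> tangent_space A p"
  and phi_field: "vector_field A X \<Longrightarrow> vector_field A (\<lambda>q. \<phi> q (X q))"
  and alpha_smooth: "vector_field A X \<Longrightarrow> smooth_fun A (\<lambda>q. \<alpha> q (X q))"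
  and beta_smooth: "vector_field A X \<Longrightarrow> smooth_fun A (\<lambda>q. \<beta> q (X q))"
  using endo form by (auto simp: endomorphism_field_def one_form_def)

lemma field_tangent: "\<xi> p \<in> tangent_space A p" "\<zeta> p \<in> tangent_space A p"
  using field vf_tangent by auto

lemma alpha_combination:
  assumes "u \<in> tangent_space A p"
  shows "\<alpha> p (u - a *\<^sub>R \<xi> p - b *\<^sub>R \<zeta> p) = \<alpha> p u - a"
  using assms
  by (simp add: linear_on_set_diff[OF alpha_linear subspace_tangent_space]
      subspace_diff[OF subspace_tangent_space] subspace_scale[OF subspace_tangent_space]
      field_tangent linear_on_set_scaleR[OF alpha_linear] dual)

text \<open>Compare \<open>\<phi>\<^sup>2 (\<phi> v)\<close>, computed from the formula for \<open>\<phi>\<^sup>2\<close>, with \<open>\<phi> (\<phi>\<^sup>2 v) = \<phi> v\<close>.\<close>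

lemma alpha_phi:
  assumes v: "v \<in> tangent_space A p"
  shows "\<alpha> p (\<phi> p v) = 0"
proof -
  have zero: "\<phi> p (\<phi> p (\<phi> p v)) = \<phi> p v"
    using v unfolding phi_phi[OF v]
    by (simp add: linear_on_set_diff[OF phi_linear subspace_tangent_space]
      subspace_diff[OF subspace_tangent_space] subspace_scale[OF subspace_tangent_space]
      field_tangent linear_on_set_scaleR[OF phi_linear] phi_fields)
  have "\<alpha> p (\<phi> p (\<phi> p (\<phi> p v))) = \<alpha> p (\<phi> p v) - \<alpha> p (\<phi> p v)"
    unfolding phi_phi[OF phi_tangent[OF v]] by (rule alpha_combination[OF phi_tangent[OF v]])
  then show ?thesis using zero by simp
qed

text \<open>Apply \<open>\<alpha>\<close> to the normality equation: all terms of the Nijenhuis tensor but one are in the image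
  of \<open>\<phi>\<close>, and duality of the frame isolates \<open>d\<alpha>\<close>.\<close>

lemma bracket_phi_phi:
  assumes X: "vector_field A X" and Y: "vector_field A Y"
  shows "\<alpha> p (lie_bracket (\<lambda>q. \<phi> q (X q)) (\<lambda>q. \<phi> q (Y q)) p) = ext_deriv \<alpha> X Y p"
proof -
  let ?FX = "\<lambda>q. \<phi> q (X q)" and ?FY = "\<lambda>q. \<phi> q (Y q)"
  note FX = phi_field[OF X] and FY = phi_field[OF Y]
  note t = lie_bracket_tangent[OF X Y, of p] lie_bracket_tangent[OF FX FY, of p]
    lie_bracket_tangent[OF FX Y, of p] lie_bracket_tangent[OF X FY, of p]
  have n: "nijenhuis \<phi> X Y p \<in> tangent_space A p"
    unfolding nijenhuis_def
    by (intro subspace_diff[OF subspace_tangent_space] subspace_add[OF subspace_tangent_space]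
        phi_tangent t)
  have "\<alpha> p (nijenhuis \<phi> X Y p) = \<alpha> p (lie_bracket ?FX ?FY p)"
    unfolding nijenhuis_def
    by (simp add: t linear_on_set_diff[OF alpha_linear subspace_tangent_space]
        linear_on_set_add[OF alpha_linear]
        subspace_diff[OF subspace_tangent_space] subspace_add[OF subspace_tangent_space]
        phi_tangent alpha_phi)
  moreover have "\<alpha> p (nijenhuis \<phi> X Y p) - ext_deriv \<alpha> X Y p = 0"
    using alpha_combination[OF n, of "ext_deriv \<alpha> X Y p" "ext_deriv \<beta> X Y p"] normal[OF X Y, of p]
      linear_on_set_zero[OF alpha_linear subspace_tangent_space] by simp
  ultimately show ?thesis by simp
qed

lemma ext_deriv_field:
  assumes X: "vector_field A X"
  shows "ext_deriv \<alpha> X \<xi> p = 0" "ext_deriv \<alpha> X \<zeta> p = 0"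
  using bracket_phi_phi[OF X field(1), of p] bracket_phi_phi[OF X field(2), of p]
  by (simp_all add: phi_fields lie_bracket_zero_right[OF phi_field[OF X]]
      linear_on_set_zero[OF alpha_linear subspace_tangent_space])

lemma alpha_bracket_commute:
  assumes X: "vector_field A X" and Y: "vector_field A Y"
  shows "\<alpha> p (lie_bracket X Y p) = - \<alpha> p (lie_bracket Y X p)"
  unfolding lie_bracket_commute[of X Y]
  by (rule linear_on_set_minus[OF alpha_linear lie_bracket_tangent[OF Y X]])

lemma alpha_bracket_field:
  assumes X: "vector_field A X"
  shows "\<alpha> p (lie_bracket X \<xi> p) = - \<xi> p (\<lambda>q. \<alpha> q (X q))"
    "\<alpha> p (lie_bracket X \<zeta> p) = - \<zeta> p (\<lambda>q. \<alpha> q (X q))"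
  using ext_deriv_field[OF X, of p] by (simp_all add: ext_deriv_def dual tangent_const[OF vf_tangent[OF X]])

lemma lie_form_field:
  assumes X: "vector_field A X"
  shows "lie_form \<xi> \<alpha> X = 0" "lie_form \<zeta> \<alpha> X = 0"
  using alpha_bracket_field[OF X] alpha_bracket_commute[OF field(1) X]
    alpha_bracket_commute[OF field(2) X]
  by (simp_all add: lie_form_def fun_eq_iff)

lemma alpha_bracket_phi_field:
  assumes X: "vector_field A X"
  shows "\<alpha> p (lie_bracket (\<lambda>q. \<phi> q (X q)) \<xi> p) = 0"
    "\<alpha> p (lie_bracket (\<lambda>q. \<phi> q (X q)) \<zeta> p) = 0"
  using alpha_bracket_field[OF phi_field[OF X], of p]
  by (simp_all add: alpha_phi[OF vf_tangent[OF X]] tangent_const[OF field_tangent(1)]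
      tangent_const[OF field_tangent(2)])

text \<open>By antisymmetry of the bracket, the Lie derivative of \<open>\<phi>\<close> along \<open>\<xi>\<close> is the field \<open>W\<close> below.
  The normality equation for \<open>X\<close> and \<open>\<xi>\<close> reduces to \<open>\<phi> W = 0\<close>; as \<open>\<alpha> W = \<beta> W = 0\<close>, the formula
  for \<open>\<phi>\<^sup>2 W\<close> gives \<open>W = 0\<close>.\<close>

lemma lie_endo_field:
  assumes X: "vector_field A X"
  shows "lie_endo \<xi> \<phi> X = 0"
proof
  fix p
  interpret swap: normal_paracontact_frame A \<phi> \<beta> \<alpha> \<zeta> \<xi> by (rule swap)
  let ?FX = "\<lambda>q. \<phi> q (X q)"
  note FX = phi_field[OF X]
  note t = lie_bracket_tangent[OF X field(1), of p] lie_bracket_tangent[OF FX field(1), of p]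
  define W where "W = \<phi> p (lie_bracket X \<xi> p) - lie_bracket ?FX \<xi> p"
  have W: "W \<in> tangent_space A p"
    unfolding W_def by (intro subspace_diff[OF subspace_tangent_space] phi_tangent t)
  have "nijenhuis \<phi> X \<xi> p = \<phi> p (\<phi> p (lie_bracket X \<xi> p)) - \<phi> p (lie_bracket ?FX \<xi> p)"
    by (simp add: nijenhuis_def phi_fields lie_bracket_zero_right[OF X]
        lie_bracket_zero_right[OF FX] linear_on_set_zero[OF phi_linear subspace_tangent_space])
  also have "\<dots> = \<phi> p W"
    unfolding W_def by (simp add: t linear_on_set_diff[OF phi_linear subspace_tangent_space] phi_tangent)
  finally have "\<phi> p W = 0"
    using normal[OF X field(1), of p] ext_deriv_field(1)[OF X, of p] swap.ext_deriv_field(2)[OF X, of p]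
    by simp
  moreover have "\<alpha> p W = 0" "\<beta> p W = 0"
    unfolding W_def
    by (simp_all add: t phi_tangent linear_on_set_diff[OF alpha_linear subspace_tangent_space]
        linear_on_set_diff[OF beta_linear subspace_tangent_space] alpha_phi swap.alpha_phi
        alpha_bracket_phi_field[OF X] swap.alpha_bracket_phi_field[OF X])
  ultimately have "W = 0"
    using phi_phi[OF W] linear_on_set_zero[OF phi_linear subspace_tangent_space, of p] by simp
  moreover have "lie_endo \<xi> \<phi> X p = W"
    using linear_on_set_minus[OF phi_linear t(1)]
    by (simp add: lie_endo_def W_def lie_bracket_commute[of \<xi>])
  ultimately show "lie_endo \<xi> \<phi> X p = 0 p" by simp
qed

text \<open>Compute \<open>\<alpha>[\<phi>\<^sup>2 X, \<phi> Y]\<close> in two ways: as \<open>d\<alpha>(\<phi> X, Y)\<close>, and by expanding \<open>\<phi>\<^sup>2 X\<close>. In the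
  expansion the brackets of \<open>\<xi>\<close> and \<open>\<zeta>\<close> with \<open>\<phi> Y\<close> are killed by \<open>\<alpha>\<close>, and only the derivative
  \<open>\<phi> Y (\<alpha> X)\<close> of the coefficient of \<open>\<xi>\<close> survives.\<close>

lemma lie_form_phi_symmetric:
  assumes X: "vector_field A X" and Y: "vector_field A Y"
  shows "lie_form (\<lambda>q. \<phi> q (X q)) \<alpha> Y = lie_form (\<lambda>q. \<phi> q (Y q)) \<alpha> X"
proof
  fix p
  let ?FX = "\<lambda>q. \<phi> q (X q)" and ?FY = "\<lambda>q. \<phi> q (Y q)"
  let ?a = "\<lambda>q. \<alpha> q (X q)" and ?b = "\<lambda>q. \<beta> q (X q)"
  note FX = phi_field[OF X] and FY = phi_field[OF Y]
  note a = alpha_smooth[OF X] and b = beta_smooth[OF X]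
  note aF = vector_field_scale[OF a field(1)] and bF = vector_field_scale[OF b field(2)]
  note t = lie_bracket_tangent[OF X FY, of p] lie_bracket_tangent[OF field(1) FY, of p]
    lie_bracket_tangent[OF field(2) FY, of p] field_tangent
  have FFX: "(\<lambda>q. \<phi> q (\<phi> q (X q))) = (\<lambda>q. X q - ?a q *\<^sub>R \<xi> q - ?b q *\<^sub>R \<zeta> q)"
    using phi_phi[OF vf_tangent[OF X]] by blast
  have br: "lie_bracket (\<lambda>q. \<phi> q (\<phi> q (X q))) ?FY p = lie_bracket X ?FY p
      - (?a p *\<^sub>R lie_bracket \<xi> ?FY p - ?FY p ?a *\<^sub>R \<xi> p)
      - (?b p *\<^sub>R lie_bracket \<zeta> ?FY p - ?FY p ?b *\<^sub>R \<zeta> p)"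
    unfolding FFX lie_bracket_diff_left[OF vector_field_diff[OF X aF] bF FY]
      lie_bracket_diff_left[OF X aF FY] lie_bracket_scale_left[OF a field(1) FY]
      lie_bracket_scale_left[OF b field(2) FY] ..
  have zero: "\<alpha> p (lie_bracket \<xi> ?FY p) = 0" "\<alpha> p (lie_bracket \<zeta> ?FY p) = 0"
    using alpha_bracket_commute[OF field(1) FY, of p] alpha_bracket_commute[OF field(2) FY, of p]
      alpha_bracket_phi_field[OF Y, of p] by simp_all
  have "\<alpha> p (lie_bracket (\<lambda>q. \<phi> q (\<phi> q (X q))) ?FY p) = \<alpha> p (lie_bracket X ?FY p) + ?FY p ?a"
    unfolding br
    by (simp add: t linear_on_set_diff[OF alpha_linear subspace_tangent_space]
      subspace_diff[OF subspace_tangent_space] subspace_scale[OF subspace_tangent_space]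
      linear_on_set_scaleR[OF alpha_linear] dual zero)
  moreover have "\<alpha> p (lie_bracket (\<lambda>q. \<phi> q (\<phi> q (X q))) ?FY p)
      = ?FX p (\<lambda>q. \<alpha> q (Y q)) - \<alpha> p (lie_bracket ?FX Y p)"
    unfolding bracket_phi_phi[OF FX Y]
    by (simp add: ext_deriv_def alpha_phi[OF vf_tangent[OF X]] tangent_const[OF vf_tangent[OF Y]])
  ultimately show "lie_form ?FX \<alpha> Y p = lie_form ?FY \<alpha> X p"
    using alpha_bracket_commute[OF X FY, of p] by (simp add: lie_form_def)
qed

end

section \<open>Normal paracontact Finsler structures\<close>

text \<open>Each part of \<open>\<eta>\<close> vanishes on the other part of \<open>\<xi>\<close> because the projections do. That \<open>\<phi>\<close> kills
  both distinguished fields uses that it preserves the two bundles: on the horizontal field, say,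
  the \<open>\<eta>\<^sup>V\<close> term of \<open>\<phi>\<^sup>2\<close> then drops out.\<close>

lemma (in connection_over_base) paracontact_frame:
  assumes pc: "almost_paracontact_finsler atE H V \<phi> \<eta> \<xi>"
    and normal: "\<forall>X Y. vector_field atE X \<longrightarrow> vector_field atE Y \<longrightarrow> N1 H V \<phi> \<eta> \<xi> X Y = 0"
  shows "normal_paracontact_frame atE \<phi> (form_part H V \<eta>) (form_part V H \<eta>)
    (vf_part H V \<xi>) (vf_part V H \<xi>)"
proof
  let ?h = "vf_part H V \<xi>" and ?v = "vf_part V H \<xi>"
  have endo: "endomorphism_field atE \<phi>" and form: "one_form atE \<eta>" and field: "vector_field atE \<xi>"
    and pres: "\<And>p v. v \<in> H p \<Longrightarrow> \<phi> p v \<in> H p" "\<And>p v. v \<in> V p \<Longrightarrow> \<phi> p v \<in> V p"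
    and sq: "\<And>p v. v \<in> tangent_space atE p \<Longrightarrow>
        \<phi> p (\<phi> p v) = v - form_part H V \<eta> p v *\<^sub>R ?h p - form_part V H \<eta> p v *\<^sub>R ?v p"
    and one: "\<And>p. form_part H V \<eta> p (?h p) = 1" "\<And>p. form_part V H \<eta> p (?v p) = 1"
    using pc unfolding almost_paracontact_finsler_def by blast+
  have eta0: "\<eta> p 0 = 0" for p
    using form E.subspace_tangent_space linear_on_set_zero unfolding one_form_def by blast
  note parts = vf_part_mem(1,3)[OF field]
  have vanish: "form_part H V \<eta> p w = 0" if "w \<in> V p" for p w
    using proj_decompose(1)[OF subspace_0[OF subspace_H] that] eta0 by (simp add: form_part_def)
  have vanish': "form_part V H \<eta> p w = 0" if "w \<in> H p" for p w
    using proj_decompose(2)[OF that subspace_0[OF subspace_V]] eta0 by (simp add: form_part_def)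
  have lin: "linear_on_set (tangent_space atE p) (\<phi> p)" for p
    using endo by (simp add: endomorphism_field_def)
  have inT: "v \<in> tangent_space atE p" if "v \<in> H p \<or> v \<in> V p" for p v
    using that H_subset V_subset by blast
  show "\<phi> p (?h p) = 0" for p
  proof (rule linear_on_set_cube_eq_zero[OF lin])
    show "?h p \<in> tangent_space atE p" using parts inT by blast
    then show "\<phi> p (\<phi> p (?h p)) = 0" using sq vanish'[OF parts(1)] one by simp
    show "\<phi> p (\<phi> p (\<phi> p (?h p))) = \<phi> p (?h p) - form_part H V \<eta> p (\<phi> p (?h p)) *\<^sub>R ?h p"
      using sq[OF inT, of "\<phi> p (?h p)"] pres(1)[OF parts(1)] vanish' by simp
  qed (rule E.subspace_tangent_space)
  show "\<phi> p (?v p) = 0" for p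
  proof (rule linear_on_set_cube_eq_zero[OF lin])
    show "?v p \<in> tangent_space atE p" using parts inT by blast
    then show "\<phi> p (\<phi> p (?v p)) = 0" using sq vanish[OF parts(2)] one by simp
    show "\<phi> p (\<phi> p (\<phi> p (?v p))) = \<phi> p (?v p) - form_part V H \<eta> p (\<phi> p (?v p)) *\<^sub>R ?v p"
      using sq[OF inT, of "\<phi> p (?v p)"] pres(2)[OF parts(2)] vanish by simp
  qed (rule E.subspace_tangent_space)
  show "form_part H V \<eta> p (?v p) = 0" "form_part V H \<eta> p (?h p) = 0" for p
    by (rule vanish[OF parts(2)], rule vanish'[OF parts(1)])
  show "nijenhuis \<phi> X Y p - ext_deriv (form_part H V \<eta>) X Y p *\<^sub>R ?h p
      - ext_deriv (form_part V H \<eta>) X Y p *\<^sub>R ?v p = 0"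
    if "vector_field atE X" "vector_field atE Y" for X Y p
    using fun_cong[OF normal[rule_format, OF that], of p] by (simp add: N1_def)
  show "endomorphism_field atE \<phi>" by (rule endo)
  show "one_form atE (form_part H V \<eta>)" "one_form atE (form_part V H \<eta>)"
    by (rule one_form_parts[OF form])+
  show "vector_field atE ?h" "vector_field atE ?v" by (rule vector_field_parts[OF field])+
  show "form_part H V \<eta> p (?h p) = 1" "form_part V H \<eta> p (?v p) = 1" for p by (rule one)+
  show "\<phi> p (\<phi> p v) = v - form_part H V \<eta> p v *\<^sub>R ?h p - form_part V H \<eta> p v *\<^sub>R ?v p"
    if "v \<in> tangent_space atE p" for v p using that by (rule sq)
qed

theorem theorem3p5:
  fixes atE :: "('e::{second_countable_topology,t2_space},
                'b::euclidean_space \<times> 'f::euclidean_space) chart set"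
    and atM :: "('m::{second_countable_topology,t2_space}, 'b) chart set"
    and \<pi> :: "'e \<Rightarrow> 'm"
    and vadd :: "'e \<Rightarrow> 'e \<Rightarrow> 'e" and scl :: "real \<Rightarrow> 'e \<Rightarrow> 'e"
    and HE VE :: "'e \<Rightarrow> 'e tvec set"
    and \<phi> :: "'e \<Rightarrow> 'e tvec \<Rightarrow> 'e tvec"
    and \<eta> :: "'e \<Rightarrow> 'e tvec \<Rightarrow> real"
    and \<xi> :: "'e \<Rightarrow> 'e tvec"
  assumes "smooth_vector_bundle atE atM \<pi> vadd scl"
    and "VE = vertical_bundle atE atM \<pi>"
    and "nonlinear_connection atE atM \<pi> HE"
    and "almost_paracontact_finsler atE HE VE \<phi> \<eta> \<xi>"
    and "\<forall>X Y. vector_field atE X \<longrightarrow> vector_field atE Y \<longrightarrow> N1 HE VE \<phi> \<eta> \<xi> X Y = 0"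
  shows "(\<forall>X Y. vector_field atE X \<longrightarrow> vector_field atE Y \<longrightarrow>
            N2_HH HE VE \<phi> \<eta> X Y = 0 \<and>
            N2_VV HE VE \<phi> \<eta> X Y = 0 \<and>
            N2_VH HE VE \<phi> \<eta> X Y = 0) \<and>
         (\<forall>X. vector_field atE X \<longrightarrow>
            N3_HH HE VE \<phi> \<xi> X = 0 \<and> N3_VV HE VE \<phi> \<xi> X = 0 \<and>
            N3_HV HE VE \<phi> \<xi> X = 0 \<and> N3_VH HE VE \<phi> \<xi> X = 0) \<and>
         (\<forall>X. vector_field atE X \<longrightarrow>
            N4_HH HE VE \<eta> \<xi> X = 0 \<and> N4_VV HE VE \<eta> \<xi> X = 0 \<and>
            N4_HV HE VE \<eta> \<xi> X = 0 \<and> N4_VH HE VE \<eta> \<xi> X = 0)"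
proof -
  interpret connection_over_base atE atM \<pi> HE VE
    using assms(1-3) by unfold_locales (simp_all add: smooth_vector_bundle_def)
  interpret h: normal_paracontact_frame atE \<phi> "form_part HE VE \<eta>" "form_part VE HE \<eta>"
      "vf_part HE VE \<xi>" "vf_part VE HE \<xi>"
    by (rule paracontact_frame[OF assms(4,5)])
  interpret v: normal_paracontact_frame atE \<phi> "form_part VE HE \<eta>" "form_part HE VE \<eta>"
      "vf_part VE HE \<xi>" "vf_part HE VE \<xi>"
    by (rule h.swap)
  show ?thesis
  proof (intro conjI allI impI)
    fix X Y assume "vector_field atE X" "vector_field atE Y"
    note parts = vector_field_parts[OF this(1)] vector_field_parts[OF this(2)]
    show "N2_HH HE VE \<phi> \<eta> X Y = 0"
      by (simp add: N2_HH_def h.lie_form_phi_symmetric[OF parts(1,3)])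
    show "N2_VV HE VE \<phi> \<eta> X Y = 0"
      by (simp add: N2_VV_def v.lie_form_phi_symmetric[OF parts(2,4)])
    show "N2_VH HE VE \<phi> \<eta> X Y = 0"
      by (simp add: N2_VH_def h.lie_form_phi_symmetric[OF parts(2,3)]
          v.lie_form_phi_symmetric[OF parts(2,3)])
  next
    fix X assume "vector_field atE X"
    note parts = vector_field_parts[OF this]
    show "N3_HH HE VE \<phi> \<xi> X = 0" "N3_VV HE VE \<phi> \<xi> X = 0"
      "N3_HV HE VE \<phi> \<xi> X = 0" "N3_VH HE VE \<phi> \<xi> X = 0"
      by (simp_all add: N3_HH_def N3_VV_def N3_HV_def N3_VH_def parts
          h.lie_endo_field v.lie_endo_field)
    show "N4_HH HE VE \<eta> \<xi> X = 0" "N4_VV HE VE \<eta> \<xi> X = 0"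
      "N4_HV HE VE \<eta> \<xi> X = 0" "N4_VH HE VE \<eta> \<xi> X = 0"
      by (simp_all add: N4_HH_def N4_VV_def N4_HV_def N4_VH_def parts
          h.lie_form_field v.lie_form_field)
  qed
qed

end
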